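(* The function $\mathrm{Maya}(\lambda)\mapsto\#\mathrm{SYT}(\lambda)$, where $\lambda$ ranges over all partitions (of unbounded length and width), is in $\#\mathsf{L}$.
   Context: The Young diagram of a partition $\lambda$ of $n$ is $[\lambda]=\{(i,j)\mid 1\le j\le\lambda_i\}$, drawn in the English convention (rows of lengths $\lambda_1\ge\lambda_2\ge\cdots$ from top to bottom, left-justified). $\mathrm{SYT}(\lambda)$ is the set of standard Young tableaux of shape $\lambda$: bijections $T:[\lambda]\to\{1,\dots,n\}$ increasing along rows and down columns. The Maya diagram $\mathrm{Maya}(\lambda)\in\{0,1\}^{\lambda_1+\ell(\lambda)}$ is the string reading the outline of $[\lambda]$ from its bottom-left to its top-right corner, writing $1$ for each up-step and $0$ for each right-step; for instance $\mathrm{Maya}(7,7,6,4,3,2,2)=00110101001011$. The alphabet is $\Sigma=\{0,1\}$. A function given only on strings of a specified form is extended by $0$ to all other strings. $\#\mathsf{L}$ is the class of functions $f:\Sigma^*\to\mathbb{N}_0$ such that $f(x)$ is the number of accepting computation paths on input $x$ of a fixed nondeterministic Turing machine with read-only input tape that uses $O(\log|x|)$ work space and halts on every computation path. Equivalently: there are a polynomial $q$ and a deterministic $O(\log|x|)$-space Turing machine $M$ with an additional read-once, left-to-right witness tape such that $f(x)=\#\{w\in\Sigma^{q(|x|)}\mid M(x,w)=\mathsf{yes}\}$. *)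

theory Defs
  imports Complex_Main "HOL-Library.FuncSet" "HOL-Library.Landau_Symbols"
begin

section \<open>Partitions and standard Young tableaux\<close>

definition is_partition :: "nat list \<Rightarrow> bool" where
  "is_partition l \<longleftrightarrow> sorted_wrt (\<ge>) l \<and> 0 \<notin> set l"

text \<open>Rows and columns are numbered from 1, while list positions start at 0.\<close>

definition young_diagram :: "nat list \<Rightarrow> (nat \<times> nat) set" where
  "young_diagram l = {(i, j). 1 \<le> i \<and> i \<le> length l \<and> 1 \<le> j \<and> j \<le> l ! (i - 1)}"

text \<open>Tableaux are extensional functions, so that distinct elements of \<open>SYT l\<close> differ on
  the diagram and the cardinality of \<open>SYT l\<close> is the number of tableaux.\<close>

definition SYT :: "nat list \<Rightarrow> (nat \<times> nat \<Rightarrow> nat) set" where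
  "SYT l = {T \<in> extensional (young_diagram l).
     bij_betw T (young_diagram l) {1..sum_list l} \<and>
     (\<forall>i j j'. (i, j) \<in> young_diagram l \<and> (i, j') \<in> young_diagram l \<and> j < j'
        \<longrightarrow> T (i, j) < T (i, j')) \<and>
     (\<forall>i i' j. (i, j) \<in> young_diagram l \<and> (i', j) \<in> young_diagram l \<and> i < i'
        \<longrightarrow> T (i, j) < T (i', j))}"


section \<open>Maya diagrams\<close>

text \<open>Strings over the alphabet \<open>{0, 1}\<close> are Boolean lists, with \<open>True\<close> for 1 (an up-step)
  and \<open>False\<close> for 0 (a right-step). The outline is read from the bottom row to the top row:
  the end of the row below is extended to the end of the present row, then one step up is
  made.\<close>

fun maya :: "nat list \<Rightarrow> bool list" where
  "maya [] = []"
| "maya (a # l) = maya l @ replicate (a - (case l of [] \<Rightarrow> 0 | b # _ \<Rightarrow> b)) False @ [True]"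

lemma maya_example:
  "map (of_bool :: bool \<Rightarrow> nat) (maya [7, 7, 6, 4, 3, 2, 2]) = [0,0,1,1,0,1,0,1,0,0,1,0,1,1]"
  by (simp add: numeral_eq_Suc)

lemma is_partition_Cons:
  "is_partition (a # l) \<longleftrightarrow> 0 < a \<and> (\<forall>b\<in>set l. b \<le> a) \<and> is_partition l"
  by (auto simp: is_partition_def)

lemma length_maya: "is_partition (a # l) \<Longrightarrow> length (maya (a # l)) = a + length (a # l)"
proof (induction l arbitrary: a)
  case (Cons b l)
  then show ?case by (auto simp: is_partition_Cons simp del: maya.simps(2) simp: maya.simps(2)[of a])
qed simp

lemma count_True_maya: "count_list (maya l) True = length l"
proof (induction l)
  case (Cons a l)
  have "count_list (replicate n False) True = 0" for n
    by (induction n) auto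
  with Cons show ?case by simp
qed simp

lemma maya_inj:
  assumes "is_partition l" "is_partition l'" "maya l = maya l'"
  shows "l = l'"
  using assms
proof (induction l arbitrary: l')
  case Nil
  then show ?case by (cases l') auto
next
  case (Cons a l)
  then obtain a' l1 where l': "l' = a' # l1" by (cases l') auto
  define z z' where "z = a - (case l of [] \<Rightarrow> 0 | b # _ \<Rightarrow> b)"
    and "z' = a' - (case l1 of [] \<Rightarrow> 0 | b # _ \<Rightarrow> b)"
  have eq: "maya l @ replicate z False = maya l1 @ replicate z' False"
    using Cons.prems(3) by (simp add: l' z_def z'_def)
  have drop: "rev (dropWhile Not (rev (maya m @ replicate n False))) = maya m" for m n
  proof -
    have "dropWhile Not (replicate n False @ ys) = dropWhile Not ys" for ys
      by (induction n) auto
    then show ?thesis by (cases m) auto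
  qed
  have "maya l = maya l1" using drop eq by metis
  then have "l = l1" using Cons l' by (auto simp: is_partition_Cons)
  moreover have "a + length (a # l) = a' + length (a' # l1)"
    using length_maya Cons.prems l' by metis
  ultimately show ?case using l' by simp
qed

definition maya_syt_count :: "bool list \<Rightarrow> nat" where
  "maya_syt_count x =
     (if \<exists>l. is_partition l \<and> maya l = x
      then card (SYT (THE l. is_partition l \<and> maya l = x)) else 0)"

lemma maya_syt_count_maya: "is_partition l \<Longrightarrow> maya_syt_count (maya l) = card (SYT l)"
proof -
  assume l: "is_partition l"
  then have "(THE l'. is_partition l' \<and> maya l' = maya l) = l"
    using maya_inj by (intro the_equality) auto
  with l show ?thesis by (auto simp: maya_syt_count_def)
qed

lemma maya_syt_count_other:
  "(\<And>l. is_partition l \<Longrightarrow> maya l \<noteq> x) \<Longrightarrow> maya_syt_count x = 0"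
  by (auto simp: maya_syt_count_def)


section \<open>Nondeterministic Turing machines with read-only input\<close>

datatype input_symbol = Left_End | Right_End | Bit bool

datatype direction = Move_Left | Stay | Move_Right

fun shift :: "direction \<Rightarrow> int" where
  "shift Move_Left = -1"
| "shift Stay = 0"
| "shift Move_Right = 1"

text \<open>A machine has a read-only two-way input tape with end markers and a fixed number of
  two-way infinite work tapes. The transition function maps the state, the scanned input
  symbol and the scanned work symbols to the set of possible actions: new state, move of the
  input head, and for each work tape the symbol to be written and the move of its head.\<close>

record ('q, 's) ntm =
  states :: "'q set"
  alphabet :: "'s set"
  blank :: 's
  work_tapes :: nat
  start :: 'q
  accepting :: "'q set"
  trans :: "'q \<Rightarrow> input_symbol \<Rightarrow> 's list \<Rightarrow> ('q \<times> direction \<times> ('s \<times> direction) list) set"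

definition wf_ntm :: "('q, 's) ntm \<Rightarrow> bool" where
  "wf_ntm M \<longleftrightarrow>
     finite (states M) \<and> finite (alphabet M) \<and> blank M \<in> alphabet M \<and>
     start M \<in> states M \<and> accepting M \<subseteq> states M \<and>
     (\<forall>q\<in>states M. \<forall>a. \<forall>bs. set bs \<subseteq> alphabet M \<and> length bs = work_tapes M \<longrightarrow>
        (\<forall>(q', d, acts) \<in> trans M q a bs.
           q' \<in> states M \<and> fst ` set acts \<subseteq> alphabet M \<and> length acts = work_tapes M \<and>
           (a = Left_End \<longrightarrow> d \<noteq> Move_Left) \<and> (a = Right_End \<longrightarrow> d \<noteq> Move_Right)))"

text \<open>The input \<open>x\<close> occupies the positions \<open>1, \<dots>, length x\<close> of the input tape. A work tape is
  represented by its contents together with its head position.\<close>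

definition input_at :: "bool list \<Rightarrow> int \<Rightarrow> input_symbol" where
  "input_at x p = (if p \<le> 0 then Left_End else if p > int (length x) then Right_End
     else Bit (x ! nat (p - 1)))"

record ('q, 's) config =
  state :: 'q
  input_head :: int
  work :: "((int \<Rightarrow> 's) \<times> int) list"

definition initial :: "('q, 's) ntm \<Rightarrow> ('q, 's) config" where
  "initial M = \<lparr>state = start M, input_head = 1,
     work = replicate (work_tapes M) (\<lambda>_. blank M, 0)\<rparr>"

definition scan :: "(int \<Rightarrow> 's) \<times> int \<Rightarrow> 's" where
  "scan = (\<lambda>(t, h). t h)"

definition act :: "'s \<times> direction \<Rightarrow> (int \<Rightarrow> 's) \<times> int \<Rightarrow> (int \<Rightarrow> 's) \<times> int" where
  "act = (\<lambda>(b, d) (t, h). (t(h := b), h + shift d))"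

definition step :: "('q, 's) ntm \<Rightarrow> bool list \<Rightarrow> ('q, 's) config \<Rightarrow> ('q, 's) config \<Rightarrow> bool" where
  "step M x c c' \<longleftrightarrow>
     (\<exists>(q, d, acts) \<in> trans M (state c) (input_at x (input_head c)) (map scan (work c)).
        c' = \<lparr>state = q, input_head = input_head c + shift d, work = map2 act acts (work c)\<rparr>)"

definition partial_path :: "('q, 's) ntm \<Rightarrow> bool list \<Rightarrow> ('q, 's) config list \<Rightarrow> bool" where
  "partial_path M x cs \<longleftrightarrow> cs \<noteq> [] \<and> hd cs = initial M \<and> successively (step M x) cs"

definition accepting_path :: "('q, 's) ntm \<Rightarrow> bool list \<Rightarrow> ('q, 's) config list \<Rightarrow> bool" where
  "accepting_path M x cs \<longleftrightarrow>
     partial_path M x cs \<and> (\<nexists>c. step M x (last cs) c) \<and> state (last cs) \<in> accepting M"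

definition halts_on_all_paths :: "('q, 's) ntm \<Rightarrow> bool list \<Rightarrow> bool" where
  "halts_on_all_paths M x \<longleftrightarrow>
     \<not> (\<exists>c :: nat \<Rightarrow> ('q, 's) config. c 0 = initial M \<and> (\<forall>i. step M x (c i) (c (Suc i))))"

text \<open>The space used along a path is the number of work tape cells visited.\<close>

definition path_space :: "('q, 's) ntm \<Rightarrow> ('q, 's) config list \<Rightarrow> nat" where
  "path_space M cs = (\<Sum>t<work_tapes M. card ((\<lambda>c. snd (work c ! t)) ` set cs))"

definition log_space :: "('q, 's) ntm \<Rightarrow> bool" where
  "log_space M \<longleftrightarrow> (\<exists>s :: nat \<Rightarrow> nat. (\<lambda>n. real (s n)) \<in> O(\<lambda>n. ln (real n)) \<and>
     (\<forall>x cs. partial_path M x cs \<longrightarrow> path_space M cs \<le> s (length x)))"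


section \<open>The class \<open>#L\<close>\<close>

text \<open>The set of accepting paths is finite, by Koenig's lemma, for a well-formed machine that
  halts on all paths. As states and work alphabets are finite sets, natural numbers suffice
  to label them.\<close>

definition sharpL :: "(bool list \<Rightarrow> nat) set" where
  "sharpL = {f. \<exists>M :: (nat, nat) ntm. wf_ntm M \<and> log_space M \<and>
     (\<forall>x. halts_on_all_paths M x \<and> f x = card {cs. accepting_path M x cs})}"

end

theory Submission
  imports Defs "HOL-Computational_Algebra.Computational_Algebra" "HOL-Library.Countable"
begin

text \<open>A cell of the diagram corresponds to a 0 of the Maya diagram followed later by a 1, and its
  hook length is the distance of the two positions. By the hook length formula the number of
  tableaux is therefore \<open>N!\<close> divided by the product of all these distances, where \<open>N\<close> is the number of
  such pairs. A prime \<open>p \<le> N\<close> occurs in this number with the exponent obtained by subtracting from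
  \<open>v\<^sub>p(1) + \<dots> + v\<^sub>p(N)\<close> the valuations \<open>v\<^sub>p\<close> of the distances. All numbers involved are polynomially
  bounded, so a machine with finitely many binary counters computes the exponent in logarithmic space;
  it then branches into \<open>p\<close> ways as often as the exponent says. Running through all primes
  \<open>p \<le> N\<close> multiplies the prime powers.

  The hook length formula is proved by removing corners. In terms of the set \<open>S\<close> of positions of
  the 1s, a removal moves an element \<open>l\<close> to \<open>l - 1\<close>, and the induction step is the identity
  \<open>(\<Sum>l\<in>S. l * (\<Prod>m\<in>S - {l}. (l - 1 - m) / (l - m))) = \<Sum>S - k * (k - 1) / 2\<close> for \<open>k = card S\<close>,
  which follows from the partial fraction expansion of \<open>\<Prod>m\<in>S. (z - 1 - m) / (z - m)\<close>.\<close>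


section \<open>The hook length formula\<close>

text \<open>Guessing a tableau entry by entry would force the machine to remember the current shape,
  and with an unbounded number of rows this does not fit into logarithmic space. The closed formula
  avoids the shape but is a quotient of numbers with polynomially many digits, and path counts lend
  themselves to addition and multiplication, not to division. Working one prime at a time turns the
  division into a subtraction of small exponents, which is done deterministically; nondeterminism is
  needed only for multiplying. Multiplication by sequential execution has its own condition: all
  paths through the first command must meet in one configuration, since otherwise what follows need
  not have the same count on each of them. Every branching therefore has to erase its traces from
  the registers, while its paths must still differ as sequences of configurations.\<close>

definition pf_coeff :: "real set \<Rightarrow> real \<Rightarrow> real" where
  "pf_coeff S l = (\<Prod>m\<in>S - {l}. (l - 1 - m) / (l - m))"

lemma pf_coeff_insert_old:
  assumes "finite S" "s \<notin> S" "l \<in> S"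
  shows "pf_coeff (insert s S) l = pf_coeff S l + pf_coeff S l / (s - l)"
proof -
  have "insert s S - {l} = insert s (S - {l})" using assms by auto
  then have "pf_coeff (insert s S) l = (l - 1 - s) / (l - s) * pf_coeff S l"
    using assms by (simp add: pf_coeff_def)
  also have "(l - 1 - s) / (l - s) = 1 + 1 / (s - l)"
    using assms by (auto simp: divide_simps) (auto simp: algebra_simps)
  finally show ?thesis by (simp add: algebra_simps)
qed

lemma pf_coeff_insert_new: "s \<notin> S \<Longrightarrow> pf_coeff (insert s S) s = (\<Prod>m\<in>S. (s - 1 - m) / (s - m))"
  by (simp add: pf_coeff_def)

text \<open>\<open>pf_coeff S l\<close> is minus the residue at \<open>l\<close> of the product,
  which tends to 1 at infinity. The induction keeps \<open>z\<close> arbitrary because the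
  coefficient of a new element \<open>s\<close> is the old product evaluated at
  \<open>z = s\<close>.\<close>

lemma partial_fractions:
  assumes "finite S" "z \<notin> S"
  shows "(\<Prod>m\<in>S. (z - 1 - m) / (z - m)) = 1 - (\<Sum>l\<in>S. pf_coeff S l / (z - l))"
  using assms
proof (induction S arbitrary: z)
  case (insert s S)
  \<comment> \<open>This splits the double pole: \<open>1 / ((s - l) * (z - l))\<close> is
    \<open>(1 / (s - l) - 1 / (z - l)) / (z - s)\<close>.\<close>
  have *: "pf_coeff S l / (z - l) + pf_coeff S l / (s - l) / (z - l) =
      pf_coeff S l / (z - l) + (pf_coeff S l / (s - l) - pf_coeff S l / (z - l)) / (z - s)" if "l \<in> S" for l
  proof -
    have "z \<noteq> l" "s \<noteq> l" "z \<noteq> s" using that insert by auto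
    then show ?thesis by (simp add: divide_simps) (simp add: algebra_simps)
  qed
  define X where "X = (\<Sum>l\<in>S. pf_coeff S l / (z - l))"
  define Y where "Y = (\<Sum>l\<in>S. pf_coeff S l / (s - l))"
  have "(\<Sum>l\<in>S. pf_coeff (insert s S) l / (z - l)) =
      (\<Sum>l\<in>S. pf_coeff S l / (z - l) + (pf_coeff S l / (s - l) - pf_coeff S l / (z - l)) / (z - s))"
    by (rule sum.cong) (use * insert in \<open>simp_all add: pf_coeff_insert_old add_divide_distrib\<close>)
  also have "\<dots> = X + (Y - X) / (z - s)"
    by (simp add: X_def Y_def sum.distrib sum_subtractf sum_divide_distrib diff_divide_distrib)
  finally have 1: "(\<Sum>l\<in>S. pf_coeff (insert s S) l / (z - l)) = X + (Y - X) / (z - s)" .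
  have 2: "pf_coeff (insert s S) s = 1 - Y"
    using insert by (simp add: pf_coeff_insert_new insert.IH[OF \<open>s \<notin> S\<close>] Y_def)
  have 3: "(\<Prod>m\<in>S. (z - 1 - m) / (z - m)) = 1 - X"
    using insert by (simp add: X_def)
  have "z \<noteq> s" using insert by auto
  then show ?case using insert.hyps
    by (simp add: 1 2 3) (simp add: divide_simps, simp add: algebra_simps)
qed simp

text \<open>Comparing the coefficients of \<open>1 / z\<close> and \<open>1 / z^2\<close> at
  infinity in \<open>partial_fractions\<close> suggests both values. The proof is one simultaneous
  induction, as the second sum needs the first.\<close>

lemma sum_pf_coeff:
  assumes "finite S"
  shows "(\<Sum>l\<in>S. pf_coeff S l) = card S"
    and "(\<Sum>l\<in>S. l * pf_coeff S l) = (\<Sum>S) - card S * (real (card S) - 1) / 2"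
  using assms
proof (induction S)
  case (insert s S)
  define Y where "Y = (\<Sum>l\<in>S. pf_coeff S l / (s - l))"
  have new: "pf_coeff (insert s S) s = 1 - Y"
    using insert by (simp add: pf_coeff_insert_new partial_fractions Y_def)
  {
    case 1
    have "(\<Sum>l\<in>S. pf_coeff (insert s S) l) = (\<Sum>l\<in>S. pf_coeff S l + pf_coeff S l / (s - l))"
      by (rule sum.cong) (use insert in \<open>simp_all add: pf_coeff_insert_old\<close>)
    then show ?case using insert new by (simp add: sum.distrib Y_def)
  next
    case 2
    have "(\<Sum>l\<in>S. l * pf_coeff (insert s S) l) = (\<Sum>l\<in>S. l * pf_coeff S l + (s * (pf_coeff S l / (s - l)) - pf_coeff S l))"
    proof (rule sum.cong)
      fix l assume "l \<in> S"
      then have "s \<noteq> l" using insert by auto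
      then show "l * pf_coeff (insert s S) l = l * pf_coeff S l + (s * (pf_coeff S l / (s - l)) - pf_coeff S l)"
        using insert \<open>l \<in> S\<close> by (simp add: pf_coeff_insert_old field_simps)
    qed simp
    also have "\<dots> = (\<Sum>l\<in>S. l * pf_coeff S l) + s * Y - card S"
      using insert.IH(1) by (simp add: sum.distrib sum_subtractf Y_def sum_distrib_left)
    finally have "(\<Sum>l\<in>insert s S. l * pf_coeff (insert s S) l) =
        (\<Sum>l\<in>S. l * pf_coeff S l) + s - card S"
      using insert.hyps by (simp add: new) (simp add: algebra_simps)
    then show ?case using insert by (simp add: field_simps)
  }
qed auto

section \<open>Hook products of finite sets of naturals\<close>

definition inversions :: "nat set \<Rightarrow> (nat \<times> nat) set" where
  "inversions S = {(a, b). a \<notin> S \<and> b \<in> S \<and> a < b}"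

definition hook_prod :: "nat set \<Rightarrow> nat" where
  "hook_prod S = (\<Prod>(a, b)\<in>inversions S. b - a)"

definition vandermonde :: "nat set \<Rightarrow> nat" where
  "vandermonde S = (\<Prod>(a, b)\<in>{(a, b). a \<in> S \<and> b \<in> S \<and> a < b}. b - a)"

lemma finite_inversions: "finite S \<Longrightarrow> finite (inversions S)"
  by (rule finite_subset[of _ "{..Max S} \<times> S"])
    (auto simp: inversions_def intro: order.trans[OF less_imp_le Max_ge])

lemma hook_prod_pos: "0 < hook_prod S"
  unfolding hook_prod_def by (rule prod_pos) (auto simp: inversions_def)

lemma vandermonde_pos: "0 < vandermonde S"
  unfolding vandermonde_def by (rule prod_pos) auto

text \<open>For \<open>b\<close> in \<open>S\<close>, \<open>fact b\<close> is the product of all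
  \<open>b - a\<close> with \<open>a < b\<close>; the \<open>a\<close> outside \<open>S\<close> give
  hook lengths, those inside give Vandermonde factors. This trades the hook product, which changes
  in many factors when an element moves, for factorials and differences that are easy to
  update.\<close>

lemma hook_prod_vandermonde:
  assumes "finite S"
  shows "hook_prod S * vandermonde S = (\<Prod>b\<in>S. fact b)"
proof -
  let ?V = "{(a, b). a \<in> S \<and> b \<in> S \<and> a < b}"
  have fin: "finite ?V" by (rule finite_subset[of _ "S \<times> S"]) (use assms in auto)
  have "fact b = (\<Prod>a<b. b - a)" for b :: nat
  proof -
    have "(\<Prod>a<b. b - a) = \<Prod>{1..b}"
      by (rule prod.reindex_bij_witness[of _ "\<lambda>c. b - c" "\<lambda>a. b - a"]) auto
    then show ?thesis by (simp add: fact_prod)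
  qed
  then have "(\<Prod>b\<in>S. fact b) = (\<Prod>b\<in>S. \<Prod>a<b. b - a)" by simp
  also have "\<dots> = (\<Prod>(b, a)\<in>Sigma S (\<lambda>b. {..<b}). b - a)"
    using assms by (simp add: prod.Sigma)
  also have "\<dots> = (\<Prod>(a, b)\<in>inversions S \<union> ?V. b - a)"
    by (rule prod.reindex_bij_witness[of _ prod.swap prod.swap]) (auto simp: inversions_def)
  also have "\<dots> = hook_prod S * vandermonde S"
    unfolding hook_prod_def vandermonde_def
    using finite_inversions[OF assms] fin
    by (intro prod.union_disjoint) (auto simp: inversions_def)
  finally show ?thesis by simp
qed

lemma vandermonde_insert:
  assumes "finite S" "s \<notin> S"
  shows "real (vandermonde (insert s S)) = vandermonde S * (\<Prod>m\<in>S. \<bar>real s - real m\<bar>)"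
proof -
  let ?V = "\<lambda>S. {(a, b). a \<in> S \<and> b \<in> S \<and> a < b}"
  let ?f = "\<lambda>m. if m < s then (m, s) else (s, m)"
  have fin: "finite (?V S)" by (rule finite_subset[of _ "S \<times> S"]) (use assms in auto)
  have neq: "m \<noteq> s" if "m \<in> S" for m using assms that by auto
  have eq: "?V (insert s S) = ?V S \<union> ?f ` S"
  proof (intro equalityI subsetI)
    fix p assume p: "p \<in> ?V (insert s S)"
    obtain a b where ab: "p = (a, b)" by (cases p)
    show "p \<in> ?V S \<union> ?f ` S"
    proof (cases "a = s \<or> b = s")
      case True
      then have "p = ?f (if a = s then b else a) \<and> (if a = s then b else a) \<in> S"
        using p ab by (cases "a = s") auto
      then show ?thesis by blast
    next
      case False
      then show ?thesis using p ab by simp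
    qed
  next
    fix p assume "p \<in> ?V S \<union> ?f ` S"
    then show "p \<in> ?V (insert s S)"
    proof
      assume "p \<in> ?f ` S"
      then obtain m where "m \<in> S" "p = ?f m" by blast
      then show ?thesis using neq[of m] by (cases "m < s") simp_all
    qed auto
  qed
  have inj: "inj_on ?f S" by (auto simp: inj_on_def split: if_splits)
  have "vandermonde (insert s S) = vandermonde S * (\<Prod>(a, b)\<in>?f ` S. b - a)"
    unfolding vandermonde_def eq
  proof (rule prod.union_disjoint)
    show "?V S \<inter> ?f ` S = {}"
    proof (rule equals0I)
      fix p assume "p \<in> ?V S \<inter> ?f ` S"
      then have "fst p \<in> S" "snd p \<in> S" "p \<in> ?f ` S" by auto
      moreover from this(3) have "fst p = s \<or> snd p = s" by (elim imageE) simp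
      ultimately show False using assms(2) by auto
    qed
  qed (use assms fin in simp_all)
  also have "(\<Prod>(a, b)\<in>?f ` S. b - a) = (\<Prod>m\<in>S. if m < s then s - m else m - s)"
    by (subst prod.reindex[OF inj], rule prod.cong) simp_all
  also have "real (vandermonde S * \<dots>) = vandermonde S * (\<Prod>m\<in>S. \<bar>real s - real m\<bar>)"
  proof -
    have "real (if m < s then s - m else m - s) = \<bar>real s - real m\<bar>" for m by auto
    then show ?thesis by (simp del: of_nat_diff)
  qed
  finally show ?thesis .
qed

text \<open>Both sets arise from the common remainder \<open>R\<close> by inserting one element, so
  in the quotient the factorials and differences within \<open>R\<close> cancel, leaving
  \<open>Suc l\<close> and a quotient of products of distances to \<open>R\<close>.\<close>

lemma hook_prod_move:
  assumes "finite S" "Suc l \<in> S" "l \<notin> S"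
  shows "real (hook_prod S) =
    hook_prod (insert l (S - {Suc l})) * (real (Suc l) * pf_coeff (real ` S) (real (Suc l)))"
proof -
  define R where "R = S - {Suc l}"
  define F where "F = (\<Prod>b\<in>R. fact b :: real)"
  define v where "v s = (\<Prod>m\<in>R. \<bar>real s - real m\<bar>)" for s
  have R: "finite R" "Suc l \<notin> R" "l \<notin> R" "S = insert (Suc l) R" using assms by (auto simp: R_def)
  have key: "real (hook_prod (insert s R)) * (vandermonde R * v s) = fact s * F" if "s \<notin> R" for s
  proof -
    have "real (hook_prod (insert s R)) * (vandermonde R * v s) =
        real (hook_prod (insert s R) * vandermonde (insert s R))"
      by (simp add: vandermonde_insert R that v_def)
    then show ?thesis using hook_prod_vandermonde[of "insert s R"] that R by (simp add: F_def)
  qed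
  have vpos: "v s > 0" if "s \<notin> R" for s
    unfolding v_def by (rule prod_pos) (use that in force)
  have "pf_coeff (real ` S) (real (Suc l)) = (\<Prod>m\<in>R. (real (Suc l) - 1 - real m) / (real (Suc l) - real m))"
  proof -
    have "real ` S - {real (Suc l)} = real ` R" using R by (auto simp del: of_nat_Suc)
    then show ?thesis by (simp add: pf_coeff_def prod.reindex inj_on_def del: of_nat_Suc)
  qed
  \<comment> \<open>No \<open>m\<close> in \<open>R\<close> equals \<open>l\<close> or
    \<open>Suc l\<close>, so numerator and denominator have the same sign.\<close>
  also have "\<dots> = (\<Prod>m\<in>R. \<bar>real l - real m\<bar> / \<bar>real (Suc l) - real m\<bar>)"
  proof (rule prod.cong[OF refl])
    fix m assume "m \<in> R"
    then have "m \<noteq> Suc l" "m \<noteq> l" using R by auto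
    then show "(real (Suc l) - 1 - real m) / (real (Suc l) - real m) = 
      \<bar>real l - real m\<bar> / \<bar>real (Suc l) - real m\<bar>"
      by (cases "m < l") (auto simp: abs_if divide_simps, simp add: algebra_simps)
  qed
  also have "\<dots> = v l / v (Suc l)" by (simp add: v_def prod_dividef)
  finally have pf_coeff: "pf_coeff (real ` S) (real (Suc l)) = v l / v (Suc l)" .
  have V: "real (vandermonde R) > 0" using vandermonde_pos by simp
  have a: "real (hook_prod S) = fact (Suc l) * F / (vandermonde R * v (Suc l))"
    using key[of "Suc l"] R V vpos[of "Suc l"] by (simp add: field_simps)
  have b: "real (hook_prod (insert l R)) = fact l * F / (vandermonde R * v l)"
    using key[of "l"] R V vpos[of "l"] by (simp add: field_simps)
  show ?thesis unfolding R_def[symmetric] pf_coeff a b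
    using V vpos[of l] vpos[of "Suc l"] R by (simp add: field_simps)
qed

text \<open>The factor for \<open>m = l\<close> vanishes. Illegal moves onto an occupied position
  thus contribute nothing, and a sum over corners extends to all rows.\<close>

lemma pf_coeff_eq_0:
  assumes "finite S" "Suc l \<in> S" "l \<in> S"
  shows "pf_coeff (real ` S) (real (Suc l)) = 0"
  unfolding pf_coeff_def using assms by (intro prod_zero) (auto intro!: bexI[of _ "l"])

section \<open>Beta numbers of a partition and removal of corners\<close>

definition beta :: "nat list \<Rightarrow> nat \<Rightarrow> nat" where
  "beta l i = l ! i + (length l - 1 - i)"

definition betas :: "nat list \<Rightarrow> nat set" where
  "betas l = beta l ` {..<length l}"

definition corners :: "nat list \<Rightarrow> nat set" where
  "corners l = {i. i < length l \<and> 0 < l ! i \<and> (Suc i < length l \<longrightarrow> l ! Suc i < l ! i)}"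

abbreviation shrink :: "nat list \<Rightarrow> nat \<Rightarrow> nat list" where
  "shrink l i \<equiv> l[i := l ! i - 1]"

lemma beta_less:
  assumes "sorted_wrt (\<ge>) l" "i < j" "j < length l"
  shows "beta l j < beta l i"
proof -
  have "l ! i \<ge> l ! j" using assms by (auto simp: sorted_wrt_iff_nth_less)
  then show ?thesis using assms by (auto simp: beta_def)
qed

lemma inj_on_beta: "sorted_wrt (\<ge>) l \<Longrightarrow> inj_on (beta l) {..<length l}"
  by (rule linorder_inj_onI) (auto dest: beta_less)

lemma finite_betas: "finite (betas l)"
  by (simp add: betas_def)

lemma card_betas: "sorted_wrt (\<ge>) l \<Longrightarrow> card (betas l) = length l"
  by (simp add: betas_def card_image inj_on_beta)

lemma sum_betas:
  assumes "sorted_wrt (\<ge>) l"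
  shows "real (\<Sum>(betas l)) = real (sum_list l) + length l * (real (length l) - 1) / 2"
proof -
  have g: "(\<Sum>i<k. real (k - 1 - i)) = k * (real k - 1) / 2" for k
  proof -
    have "(\<Sum>i<k. real (k - 1 - i)) = (\<Sum>i<k. real i)"
      by (rule sum.reindex_bij_witness[of _ "\<lambda>i. k - 1 - i" "\<lambda>i. k - 1 - i"]) auto
    also have "\<dots> = k * (real k - 1) / 2" by (induction k) (auto simp: field_simps)
    finally show ?thesis .
  qed
  have "\<Sum>(betas l) = (\<Sum>i<length l. beta l i)"
    using inj_on_beta[OF assms] by (simp add: betas_def sum.reindex)
  also have "\<dots> = sum_list l + (\<Sum>i<length l. length l - 1 - i)"
    by (simp only: beta_def sum.distrib sum_list_sum_nth atLeast0LessThan)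
  finally have "real (\<Sum>(betas l)) = real (sum_list l) + (\<Sum>i<length l. real (length l - 1 - i))"
    by (simp only: of_nat_add of_nat_sum)
  then show ?thesis by (simp only: g)
qed

lemma sorted_shrink:
  assumes "sorted_wrt (\<ge>) l" "i \<in> corners l"
  shows "sorted_wrt (\<ge>) (shrink l i)"
proof (subst sorted_wrt_iff_nth_less, intro allI impI)
  fix a b assume ab: "a < b" "b < length (shrink l i)"
  have le: "l ! a \<ge> l ! b" if "a < b" "b < length l" for a b
    using assms(1) that by (auto simp: sorted_wrt_iff_nth_less)
  show "shrink l i ! b \<le> shrink l i ! a"
  proof (cases "a = i")
    case True
    have "l ! b \<le> l ! Suc i" using le[of "Suc i" b] ab True by (cases "b = Suc i") auto
    also have "\<dots> < l ! i" using assms(2) ab True by (auto simp: corners_def)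
    finally show ?thesis using ab True by simp
  next
    case False
    then show ?thesis using ab le[of a b] by (cases "b = i") auto
  qed
qed

lemma sum_list_shrink: "i \<in> corners l \<Longrightarrow> sum_list (shrink l i) = sum_list l - 1"
  by (subst sum_list_update) (auto simp: corners_def)

text \<open>Below a corner the next row is strictly shorter, so the next beta number is smaller by
  at least two and the position just below is free.\<close>

lemma betas_shrink:
  assumes "sorted_wrt (\<ge>) l" "i \<in> corners l"
  shows "beta l i = Suc (beta l i - 1)" and "beta l i - 1 \<notin> betas l"
    and "betas (shrink l i) = insert (beta l i - 1) (betas l - {beta l i})"
proof -
  have i: "i < length l" "0 < l ! i" using assms by (auto simp: corners_def)
  show "beta l i = Suc (beta l i - 1)" using i by (simp add: beta_def)
  show "beta l i - 1 \<notin> betas l"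
  proof
    assume "beta l i - 1 \<in> betas l"
    then obtain j where j: "j < length l" "beta l j = beta l i - 1"
      unfolding betas_def by (metis imageE lessThan_iff)
    have "beta l i \<noteq> 0" using i by (simp add: beta_def)
    then have "\<not> j < i" using j i beta_less[OF assms(1), of j i] by linarith
    moreover have "j \<noteq> i" using j \<open>beta l i \<noteq> 0\<close> by auto
    ultimately have "i < j" by simp
    then have "beta l j \<le> beta l (Suc i)"
      using beta_less[OF assms(1), of "Suc i" j] j by (cases "j = Suc i") simp_all
    moreover have "beta l (Suc i) < beta l i - 1"
      using \<open>i < j\<close> j assms(2) by (auto simp: beta_def corners_def)
    ultimately show False using j by simp
  qed
  have "beta (shrink l i) j = (if j = i then beta l i - 1 else beta l j)" if "j < length l" for j
    using that i by (auto simp: beta_def)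
  then have "betas (shrink l i) = insert (beta l i - 1) (beta l ` ({..<length l} - {i}))"
    using i by (auto simp: betas_def)
  also have "beta l ` ({..<length l} - {i}) = betas l - {beta l i}"
    unfolding betas_def using inj_on_beta[OF assms(1)] i
    by (subst inj_on_image_set_diff[where C = "{..<length l}"]) auto
  finally show "betas (shrink l i) = insert (beta l i - 1) (betas l - {beta l i})" .
qed

lemma beta_not_corner:
  assumes "sorted_wrt (\<ge>) l" "i < length l" "i \<notin> corners l"
  shows "beta l i = 0 \<or> beta l i - 1 \<in> betas l"
proof (cases "Suc i < length l")
  case True
  then have "l ! Suc i \<le> l ! i" using assms(1) by (auto simp: sorted_wrt_iff_nth_less)
  then have "l ! Suc i = l ! i" using True assms by (auto simp: corners_def)
  then have "beta l i - 1 = beta l (Suc i)" using True by (auto simp: beta_def)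
  then show ?thesis using True by (auto simp: betas_def)
next
  case False
  then show ?thesis using assms by (auto simp: corners_def beta_def)
qed

text \<open>By \<open>hook_prod_move\<close> each ratio is a term of the second sum in
  \<open>sum_pf_coeff\<close>. Its value, the sum of the beta numbers minus
  \<open>k * (k - 1) / 2\<close> for \<open>k\<close> rows, is the size of the partition.\<close>

lemma sum_hook_ratio:
  assumes "sorted_wrt (\<ge>) l"
  shows "(\<Sum>i\<in>corners l. hook_prod (betas l) / hook_prod (betas (shrink l i))) = real (sum_list l)"
proof -
  let ?S = "betas l" and ?R = "real ` betas l"
  have "(\<Sum>i\<in>corners l. hook_prod ?S / hook_prod (betas (shrink l i))) =
      (\<Sum>i\<in>corners l. real (beta l i) * pf_coeff ?R (beta l i))"
  proof (rule sum.cong[OF refl])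
    fix i assume i: "i \<in> corners l"
    note b = betas_shrink[OF assms i]
    have "beta l i \<in> ?S" using i by (auto simp: betas_def corners_def)
    then have "real (hook_prod ?S) = hook_prod (betas (shrink l i)) * (beta l i * pf_coeff ?R (beta l i))"
      using hook_prod_move[of ?S "beta l i - 1"] b finite_betas by metis
    then show "hook_prod ?S / hook_prod (betas (shrink l i)) = beta l i * pf_coeff ?R (beta l i)"
      using hook_prod_pos[of "betas (shrink l i)"] by (simp add: field_simps)
  qed
  \<comment> \<open>A row that is not a corner has beta number 0 or the position below it occupied;
    either way its term is 0.\<close>
  also have "\<dots> = (\<Sum>i<length l. real (beta l i) * pf_coeff ?R (beta l i))"
  proof (rule sum.mono_neutral_left)
    show "\<forall>i\<in>{..<length l} - corners l. real (beta l i) * pf_coeff ?R (beta l i) = 0"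
    proof
      fix i assume i: "i \<in> {..<length l} - corners l"
      show "real (beta l i) * pf_coeff ?R (beta l i) = 0"
      proof (cases "beta l i")
        case (Suc b)
        then have "b \<in> ?S" "Suc b \<in> ?S"
          using beta_not_corner[OF assms, of i] i image_eqI[of "Suc b" "beta l" i]
          by (simp_all add: betas_def)
        then show ?thesis using pf_coeff_eq_0[of ?S b] Suc finite_betas by (simp del: of_nat_Suc)
      qed simp
    qed
  qed (auto simp: corners_def)
  also have "\<dots> = (\<Sum>s\<in>?R. s * pf_coeff ?R s)"
    using inj_on_beta[OF assms] by (simp add: betas_def sum.reindex)
  also have "\<dots> = real (sum_list l)"
    using sum_pf_coeff(2)[of ?R] sum_betas[OF assms] card_betas[OF assms] finite_betas
    by (simp add: card_image sum.reindex flip: of_nat_sum)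
  finally show ?thesis by simp
qed


section \<open>Removing the largest entry of a standard tableau\<close>

lemma SYT_iff:
  "T \<in> SYT l \<longleftrightarrow> T \<in> extensional (young_diagram l) \<and>
     bij_betw T (young_diagram l) {1..sum_list l} \<and>
     (\<forall>i j j'. (i, j) \<in> young_diagram l \<and> (i, j') \<in> young_diagram l \<and> j < j'
        \<longrightarrow> T (i, j) < T (i, j')) \<and>
     (\<forall>i i' j. (i, j) \<in> young_diagram l \<and> (i', j) \<in> young_diagram l \<and> i < i'
        \<longrightarrow> T (i, j) < T (i', j))"
  by (simp add: SYT_def)

lemma young_diagram_shrink:
  assumes "i \<in> corners l"
  shows "young_diagram l = insert (Suc i, l ! i) (young_diagram (shrink l i))"
    and "(Suc i, l ! i) \<notin> young_diagram (shrink l i)"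
  using assms by (auto simp: young_diagram_def corners_def nth_list_update split: if_splits)

lemma no_cell_beyond_corner:
  assumes "sorted_wrt (\<ge>) l" "i \<in> corners l"
  shows "(Suc i, j) \<in> young_diagram l \<Longrightarrow> j \<le> l ! i"
    and "(i', l ! i) \<in> young_diagram l \<Longrightarrow> i' \<le> Suc i"
proof -
  show "(Suc i, j) \<in> young_diagram l \<Longrightarrow> j \<le> l ! i" by (auto simp: young_diagram_def)
  assume "(i', l ! i) \<in> young_diagram l"
  then have i': "1 \<le> i'" "i' \<le> length l" "l ! i \<le> l ! (i' - 1)" by (auto simp: young_diagram_def)
  show "i' \<le> Suc i"
  proof (rule ccontr)
    assume "\<not> i' \<le> Suc i"
    then have "l ! (i' - 1) \<le> l ! Suc i" using i' assms(1)
      by (cases "i' - 1 = Suc i") (auto simp: sorted_wrt_iff_nth_less)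
    also have "\<dots> < l ! i" using assms(2) \<open>\<not> i' \<le> Suc i\<close> i' by (auto simp: corners_def)
    finally show False using i' by simp
  qed
qed

lemma SYT_max_corner:
  assumes "T \<in> SYT l" "0 < sum_list l"
  obtains i where "i \<in> corners l" "T (Suc i, l ! i) = sum_list l"
proof -
  note T = assms(1)[unfolded SYT_iff]
  have le: "T c \<le> sum_list l" if "c \<in> young_diagram l" for c
    using bij_betw_apply[OF conjunct1[OF conjunct2[OF T]] that] by simp
  have "sum_list l \<in> T ` young_diagram l"
    using T assms(2) by (auto simp: bij_betw_def)
  then obtain a j where aj: "(a, j) \<in> young_diagram l" "T (a, j) = sum_list l" by auto
  define i where "i = a - 1"
  have i: "a = Suc i" "i < length l" "1 \<le> j" "j \<le> l ! i"
    using aj(1) by (auto simp: young_diagram_def i_def)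
  have "\<not> j < l ! i"
  proof
    assume j: "j < l ! i"
    then have c: "(a, l ! i) \<in> young_diagram l" using i by (auto simp: young_diagram_def)
    then have "T (a, j) < T (a, l ! i)" using T aj(1) j by blast
    then show False using le[OF c] aj by simp
  qed
  then have j: "j = l ! i" using i by simp
  have "l ! Suc i < l ! i" if "Suc i < length l"
  proof (rule ccontr)
    assume "\<not> l ! Suc i < l ! i"
    then have c: "(Suc a, j) \<in> young_diagram l" using i that j by (auto simp: young_diagram_def)
    then have "T (a, j) < T (Suc a, j)" using T aj(1) by blast
    then show False using le[OF c] aj by simp
  qed
  then have "i \<in> corners l" using i j by (auto simp: corners_def)
  then show thesis using that aj i j by blast
qed

text \<open>A corner has no cell to its right or below it, so the largest entry can be put back
  without violating an order condition. Removal resets the value to \<open>undefined\<close> because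
  tableaux are extensional.\<close>

lemma SYT_remove_corner:
  assumes "sorted_wrt (\<ge>) l" "i \<in> corners l"
  shows "bij_betw (\<lambda>T. T((Suc i, l ! i) := undefined))
    {T \<in> SYT l. T (Suc i, l ! i) = sum_list l} (SYT (shrink l i))"
proof (rule bij_betw_byWitness[where f' = "\<lambda>T. T((Suc i, l ! i) := sum_list l)"])
  let ?c = "(Suc i, l ! i)" and ?n = "sum_list l"
  let ?Y = "young_diagram l" and ?Z = "young_diagram (shrink l i)"
  note Y = young_diagram_shrink[OF assms(2)]
  have n: "0 < ?n" using assms(2) elem_le_sum_list[of i l] by (auto simp: corners_def)
  have n': "sum_list (shrink l i) = ?n - 1" by (rule sum_list_shrink[OF assms(2)])
  have ins: "{1..?n} = insert ?n {1..?n - 1}" using n by auto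
  note beyond = no_cell_beyond_corner[OF assms]
  show "\<forall>T\<in>{T \<in> SYT l. T ?c = ?n}. (T(?c := undefined))(?c := ?n) = T" by auto
  show "\<forall>T\<in>SYT (shrink l i). (T(?c := ?n))(?c := undefined) = T"
    using Y by (auto simp: SYT_iff extensional_def)
  show "(\<lambda>T. T(?c := undefined)) ` {T \<in> SYT l. T ?c = ?n} \<subseteq> SYT (shrink l i)"
  proof (intro image_subsetI, elim CollectE conjE)
    fix T assume T: "T \<in> SYT l" "T ?c = ?n"
    have upd: "(T(?c := undefined)) d = T d" if "d \<in> ?Z" for d
      using that Y(2) by auto
    note T' = T(1)[unfolded SYT_iff]
    have b: "bij_betw T ?Y {1..?n}" using T' by simp
    then have "bij_betw T (?Z \<union> {?c}) ({1..?n - 1} \<union> {T ?c})"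
      unfolding Y(1) ins T(2) by simp
    then have "bij_betw T ?Z {1..?n - 1}"
      using notIn_Un_bij_betw3[of ?c ?Z T "{1..?n - 1}"] Y(2) n T(2) by simp
    then have b': "bij_betw (T(?c := undefined)) ?Z {1..?n - 1}"
      using Y by (subst bij_betw_cong[where g = T]) auto
    show "T(?c := undefined) \<in> SYT (shrink l i)"
      unfolding SYT_iff n'
    proof (intro conjI b' allI impI; (elim conjE)?)
      show "T(?c := undefined) \<in> extensional ?Z"
        using T' Y by (auto simp: extensional_def)
    next
      fix a j j' assume "(a, j) \<in> ?Z" "(a, j') \<in> ?Z" "j < j'"
      then show "(T(?c := undefined)) (a, j) < (T(?c := undefined)) (a, j')"
        unfolding upd[OF \<open>(a, j) \<in> ?Z\<close>] upd[OF \<open>(a, j') \<in> ?Z\<close>] using T' Y(1) by blast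
    next
      fix a a' j assume "(a, j) \<in> ?Z" "(a', j) \<in> ?Z" "a < a'"
      then show "(T(?c := undefined)) (a, j) < (T(?c := undefined)) (a', j)"
        unfolding upd[OF \<open>(a, j) \<in> ?Z\<close>] upd[OF \<open>(a', j) \<in> ?Z\<close>] using T' Y(1) by blast
    qed
  qed
  show "(\<lambda>T. T(?c := ?n)) ` SYT (shrink l i) \<subseteq> {T \<in> SYT l. T ?c = ?n}"
  proof (intro image_subsetI)
    fix T assume "T \<in> SYT (shrink l i)"
    note T' = this[unfolded SYT_iff n']
    have le: "T c < ?n" if "c \<in> ?Z" for c
      using bij_betw_apply[OF conjunct1[OF conjunct2[OF T']] that] n by auto
    have "bij_betw (T(?c := ?n)) ?Z {1..?n - 1}"
      using T' Y by (subst bij_betw_cong[where g = T]) auto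
    then have b': "bij_betw (T(?c := ?n)) ?Y {1..?n}"
      unfolding Y(1) ins using Y(2) n notIn_Un_bij_betw[of ?c ?Z "T(?c := ?n)" "{1..?n - 1}"]
      by simp
    have "T(?c := ?n) \<in> SYT l"
      unfolding SYT_iff
    proof (intro conjI b' allI impI; (elim conjE)?)
      show "T(?c := ?n) \<in> extensional ?Y"
        using T' Y by (auto simp: extensional_def)
    next
      fix a j j' assume c: "(a, j) \<in> ?Y" "(a, j') \<in> ?Y" "j < j'"
      have "(a, j) \<noteq> ?c" using c beyond(1)[of j'] by auto
      then have z: "(a, j) \<in> ?Z" using c Y by auto
      show "(T(?c := ?n)) (a, j) < (T(?c := ?n)) (a, j')"
      proof (cases "(a, j') = ?c")
        case True
        then show ?thesis using \<open>(a, j) \<noteq> ?c\<close> le[OF z] by simp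
      next
        case False
        then have "(a, j') \<in> ?Z" using c Y by auto
        then have "T (a, j) < T (a, j')" using z T' c by blast
        then show ?thesis using False \<open>(a, j) \<noteq> ?c\<close> by (metis fun_upd_other)
      qed
    next
      fix a a' j assume c: "(a, j) \<in> ?Y" "(a', j) \<in> ?Y" "a < a'"
      have "(a, j) \<noteq> ?c" using c beyond(2)[of a'] by auto
      then have z: "(a, j) \<in> ?Z" using c Y by auto
      show "(T(?c := ?n)) (a, j) < (T(?c := ?n)) (a', j)"
      proof (cases "(a', j) = ?c")
        case True
        then show ?thesis using \<open>(a, j) \<noteq> ?c\<close> le[OF z] by simp
      next
        case False
        then have "(a', j) \<in> ?Z" using c Y by auto
        then have "T (a, j) < T (a', j)" using z T' c by blast
        then show ?thesis using False \<open>(a, j) \<noteq> ?c\<close> by (metis fun_upd_other)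
      qed
    qed
    then show "T(?c := ?n) \<in> {T \<in> SYT l. T ?c = ?n}" by simp
  qed
qed

lemma finite_young_diagram: "finite (young_diagram l)"
proof (rule finite_subset)
  show "young_diagram l \<subseteq> Sigma {..length l} (\<lambda>i. {..l ! (i - 1)})"
    by (auto simp: young_diagram_def)
qed auto

lemma finite_SYT: "finite (SYT l)"
proof (rule finite_subset)
  show "SYT l \<subseteq> young_diagram l \<rightarrow>\<^sub>E {1..sum_list l}"
    by (auto simp: SYT_iff PiE_def simp del: atLeastAtMost_iff dest: bij_betw_apply)
qed (auto intro: finite_PiE finite_young_diagram)

lemma card_SYT_recurrence:
  assumes "sorted_wrt (\<ge>) l" "0 < sum_list l"
  shows "card (SYT l) = (\<Sum>i\<in>corners l. card (SYT (shrink l i)))"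
proof -
  let ?X = "\<lambda>i. {T \<in> SYT l. T (Suc i, l ! i) = sum_list l}"
  have "SYT l = (\<Union>i\<in>corners l. ?X i)"
    using assms(2) by (auto elim: SYT_max_corner)
  then have "card (SYT l) = card (\<Union>i\<in>corners l. ?X i)" by simp
  also have "\<dots> = (\<Sum>i\<in>corners l. card (?X i))"
  proof (rule card_UN_disjoint)
    show "finite (corners l)" by (auto simp: corners_def)
    show "\<forall>i\<in>corners l. finite (?X i)" using finite_SYT by simp
    \<comment> \<open>A tableau is injective, so only one cell holds the largest entry.\<close>
    show "\<forall>i\<in>corners l. \<forall>j\<in>corners l. i \<noteq> j \<longrightarrow> ?X i \<inter> ?X j = {}"
    proof (intro ballI impI equals0I)
      fix i j T assume ij: "i \<in> corners l" "j \<in> corners l" "i \<noteq> j" "T \<in> ?X i \<inter> ?X j"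
      then have "(Suc i, l ! i) \<in> young_diagram l" "(Suc j, l ! j) \<in> young_diagram l"
        by (auto simp: corners_def young_diagram_def)
      moreover have "inj_on T (young_diagram l)" using ij by (auto simp: SYT_iff bij_betw_def)
      ultimately have "(Suc i, l ! i) = (Suc j, l ! j)"
        using ij(4) by (intro inj_onD[of T "young_diagram l"]) auto
      then show False using ij by simp
    qed
  qed
  also have "\<dots> = (\<Sum>i\<in>corners l. card (SYT (shrink l i)))"
    by (rule sum.cong[OF refl], rule bij_betw_same_card, rule SYT_remove_corner[OF assms(1)])
  finally show ?thesis .
qed

text \<open>Over the reals the recurrence for tableaux can be divided by the hook products;
  \<open>sum_hook_ratio\<close> then supplies exactly the factor \<open>Suc n\<close> that turns
  \<open>fact n\<close> into \<open>fact (Suc n)\<close>.\<close>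

theorem hook_length_formula:
  assumes "sorted_wrt (\<ge>) l"
  shows "card (SYT l) * hook_prod (betas l) = fact (sum_list l)"
  using assms
proof (induction "sum_list l" arbitrary: l)
  case 0
  then have z: "\<And>i. i < length l \<Longrightarrow> l ! i = 0" by (metis nth_mem sum_list_eq_0_iff)
  then have "young_diagram l = {}" by (force simp: young_diagram_def)
  then have "SYT l = {\<lambda>_. undefined}" using 0 by (auto simp: SYT_def bij_betw_def)
  \<comment> \<open>With all parts zero the beta numbers form an initial segment, so there are no
    inversions and the hook product is empty.\<close>
  moreover have "betas l = {..<length l}"
  proof -
    have "betas l = (\<lambda>i. length l - 1 - i) ` {..<length l}"
      using z by (auto simp: betas_def beta_def)
    also have "\<dots> = {..<length l}"
    proof (intro equalityI subsetI)
      fix x assume "x \<in> {..<length l}"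
      then show "x \<in> (\<lambda>i. length l - 1 - i) ` {..<length l}"
        by (intro image_eqI[of _ _ "length l - 1 - x"]) auto
    qed auto
    finally show ?thesis .
  qed
  then have "inversions (betas l) = {}" unfolding inversions_def by force
  then have "hook_prod (betas l) = 1" by (simp add: hook_prod_def)
  ultimately show ?case by (simp flip: 0(1))
next
  case (Suc n)
  let ?H = "\<lambda>l. real (hook_prod (betas l))"
  have IH: "real (card (SYT (shrink l i))) = fact n / ?H (shrink l i)" if "i \<in> corners l" for i
  proof -
    have "card (SYT (shrink l i)) * hook_prod (betas (shrink l i)) = fact n"
      using Suc.hyps(1)[of "shrink l i"] sorted_shrink[OF Suc.prems that]
        sum_list_shrink[OF that] by (simp flip: Suc.hyps(2))
    then have "real (card (SYT (shrink l i))) * ?H (shrink l i) = fact n"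
      by (metis of_nat_fact of_nat_mult)
    then show ?thesis using hook_prod_pos[of "betas (shrink l i)"] by (simp add: field_simps)
  qed
  have "real (card (SYT l)) = (\<Sum>i\<in>corners l. fact n / ?H (shrink l i))"
    using card_SYT_recurrence[OF Suc.prems] IH by (simp flip: Suc.hyps(2))
  then have "real (card (SYT l)) * ?H l = fact n * (\<Sum>i\<in>corners l. ?H l / ?H (shrink l i))"
    by (simp add: sum_distrib_left sum_distrib_right mult.commute)
  also have "\<dots> = fact (sum_list l)"
    using sum_hook_ratio[OF Suc.prems] by (simp add: mult.commute flip: Suc.hyps(2))
  finally show ?case by (metis of_nat_eq_iff of_nat_fact of_nat_mult)
qed


section \<open>Maya diagrams and prime exponents\<close>

definition ones :: "bool list \<Rightarrow> nat set" where
  "ones x = {i. i < length x \<and> x ! i}"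

lemma finite_ones: "finite (ones x)"
  by (simp add: ones_def)

lemma betas_Cons: "betas (a # l) = insert (a + length l) (betas l)"
proof -
  have "{..<length (a # l)} = insert 0 (Suc ` {..<length l})"
    by (simp add: lessThan_Suc_eq_insert_0)
  moreover have "beta (a # l) (Suc i) = beta l i" for i by (simp add: beta_def)
  moreover have "beta (a # l) 0 = a + length l" by (simp add: beta_def)
  ultimately show ?thesis by (simp add: betas_def image_image)
qed

lemma ones_append:
  "ones (x @ replicate k False @ [True]) = insert (length x + k) (ones x)"
  by (auto simp: ones_def nth_append)

lemma length_maya': "is_partition l \<Longrightarrow> length (maya l) = (case l of [] \<Rightarrow> 0 | a # _ \<Rightarrow> a) + length l"
  by (cases l) (auto dest: length_maya)

text \<open>The up-step of a row is preceded by one 0 for each cell of the row and by one 1 for each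
  row below it, which adds up to its beta number.\<close>

lemma ones_maya: "is_partition l \<Longrightarrow> ones (maya l) = betas l"
proof (induction l)
  case Nil
  show ?case by (simp add: ones_def betas_def)
next
  case (Cons a l)
  then have "(case l of [] \<Rightarrow> 0 | b # _ \<Rightarrow> b) \<le> a" by (auto simp: is_partition_Cons split: list.split)
  then show ?case using Cons
    by (auto simp: ones_append betas_Cons is_partition_Cons length_maya')
qed

definition maya_valid :: "bool list \<Rightarrow> bool" where
  "maya_valid x \<longleftrightarrow> x = [] \<or> \<not> hd x \<and> last x"

lemma maya_valid_maya: "is_partition l \<Longrightarrow> maya_valid (maya l)"
proof (induction l)
  case (Cons a l)
  then show ?case
    by (cases l) (auto simp: maya_valid_def is_partition_Cons hd_append)
qed (simp add: maya_valid_def)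

text \<open>The diagram is decoded one row at a time: the final 1 is the up-step of the top row, and
  the run of 0s before it is the excess over the row below.\<close>

lemma maya_valid_ex: "maya_valid x \<Longrightarrow> \<exists>l. is_partition l \<and> maya l = x"
proof (induction x rule: length_induct)
  case (1 x)
  show ?case
  proof (cases "x = []")
    case True
    then show ?thesis by (intro exI[of _ "[]"]) (simp add: is_partition_def)
  next
    case False
    then have x: "\<not> hd x" "last x" using 1 by (auto simp: maya_valid_def)
    define x' where "x' = butlast x"
    define y where "y = rev (dropWhile Not (rev x'))"
    define k where "k = length (takeWhile Not (rev x'))"
    have "rev x' = takeWhile Not (rev x') @ dropWhile Not (rev x')" by simp
    then have "x' = y @ rev (takeWhile Not (rev x'))"
      unfolding y_def by (metis rev_append rev_rev_ident)
    also have "takeWhile Not (rev x') = replicate k False"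
      unfolding k_def by (rule replicate_eqI) (auto dest!: set_takeWhileD)
    finally have x': "x' = y @ replicate k False" by simp
    have "x = x' @ [True]"
      using x(2) False append_butlast_last_id[of x] by (simp add: x'_def)
    then have eq: "x = y @ replicate k False @ [True]" unfolding x' by simp
    have "last y" if "y \<noteq> []"
      using that hd_dropWhile[of Not "rev x'"] by (simp add: y_def last_rev)
    moreover have "\<not> hd y" if "y \<noteq> []" using that x(1) unfolding eq by simp
    ultimately have "maya_valid y" by (auto simp: maya_valid_def)
    then obtain l where l: "is_partition l" "maya l = y" 
      using "1.IH"[rule_format, of y] by (auto simp: eq)
    define a where "a = k + (case l of [] \<Rightarrow> 0 | b # _ \<Rightarrow> b)"
    have "maya (a # l) = x" using l eq by (simp add: a_def)
    moreover have "is_partition (a # l)"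
    proof (cases l)
      case Nil
      \<comment> \<open>Here \<open>x\<close> is \<open>k\<close> zeros and a one; as it begins with
        0, the only row is not empty.\<close>
      then have "k \<noteq> 0" using x eq l by (cases k) auto
      then show ?thesis using Nil by (simp add: is_partition_def a_def)
    next
      case (Cons b l')
      then show ?thesis using l(1) by (auto simp: is_partition_Cons a_def)
    qed
    ultimately show ?thesis by blast
  qed
qed

text \<open>The top row has the largest beta number \<open>a + length l\<close>; below it lie
  \<open>length l\<close> occupied positions, hence \<open>a\<close> free ones, one for each cell of
  the row.\<close>

lemma card_inversions_betas: "is_partition l \<Longrightarrow> card (inversions (betas l)) = sum_list l"
proof (induction l)
  case Nil
  then show ?case by (simp add: betas_def inversions_def)
next
  case (Cons a l)
  let ?b = "a + length l"
  have p: "is_partition l" "\<And>b. b \<in> set l \<Longrightarrow> b \<le> a" using Cons by (auto simp: is_partition_Cons)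
  have less: "s < ?b" if "s \<in> betas l" for s
  proof -
    obtain i where "i < length l" "s = beta l i" using \<open>s \<in> betas l\<close> by (auto simp: betas_def)
    then show ?thesis using p(2)[of "l ! i"] by (simp add: beta_def)
  qed
  have "inversions (betas (a # l)) = inversions (betas l) \<union> ({..<?b} - betas l) \<times> {?b}"
    using less by (fastforce simp: inversions_def betas_Cons)
  moreover have "inversions (betas l) \<inter> ({..<?b} - betas l) \<times> {?b} = {}"
    using less by (auto simp: inversions_def)
  moreover have "card (({..<?b} - betas l) \<times> {?b}) = a"
  proof -
    have "betas l \<subseteq> {..<?b}" using less by auto
    then have "card ({..<?b} - betas l) = ?b - length l"
      using p(1) by (simp add: card_Diff_subset finite_betas card_betas is_partition_def)
    then show ?thesis by (simp add: card_cartesian_product)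
  qed
  ultimately show ?case
    using Cons.IH[OF p(1)] by (simp add: card_Un_disjoint finite_inversions finite_betas)
qed

theorem hook_formula_maya:
  assumes "maya_valid x"
  shows "maya_syt_count x * hook_prod (ones x) = fact (card (inversions (ones x)))"
proof -
  obtain l where l: "is_partition l" "maya l = x" using maya_valid_ex[OF assms] by blast
  then have "ones x = betas l" "maya_syt_count x = card (SYT l)"
    using ones_maya maya_syt_count_maya by auto
  then show ?thesis
    using hook_length_formula[of l] card_inversions_betas[OF l(1)] l(1) by (simp add: is_partition_def)
qed

lemma maya_syt_count_invalid: "\<not> maya_valid x \<Longrightarrow> maya_syt_count x = 0"
  using maya_valid_maya maya_syt_count_other by metis

section \<open>Prime factorization of the number of tableaux\<close>

definition syt_exponent :: "bool list \<Rightarrow> nat \<Rightarrow> nat" where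
  "syt_exponent x p = (\<Sum>m=1..card (inversions (ones x)). multiplicity p m) -
     (\<Sum>(a, b)\<in>inversions (ones x). multiplicity p (b - a))"

text \<open>Valuations are additive on the hook formula. The inequality makes the truncated
  subtraction in the definition exact, and it later keeps the exponent counter from being
  decremented at zero.\<close>

lemma syt_exponent:
  assumes "maya_valid x" "prime p"
  shows "(\<Sum>(a, b)\<in>inversions (ones x). multiplicity p (b - a))
      \<le> (\<Sum>m=1..card (inversions (ones x)). multiplicity p m)" (is ?le)
    and "multiplicity p (maya_syt_count x) = syt_exponent x p" (is ?eq)
proof -
  let ?I = "inversions (ones x)"
  note f = hook_formula_maya[OF assms(1)]
  have "maya_syt_count x \<noteq> 0" using f by (metis fact_nonzero mult_eq_0_iff)
  then have "multiplicity p (fact (card ?I) :: nat) =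
      multiplicity p (maya_syt_count x) + multiplicity p (hook_prod (ones x))"
    using hook_prod_pos[of "ones x"] assms(2) unfolding f[symmetric]
    by (subst prime_elem_multiplicity_mult_distrib) auto
  moreover have "multiplicity p (fact (card ?I) :: nat) = (\<Sum>m=1..card ?I. multiplicity p m)"
    unfolding fact_prod of_nat_id
    using assms(2) by (subst prime_elem_multiplicity_prod_distrib) auto
  moreover have "multiplicity p (hook_prod (ones x)) = (\<Sum>(a, b)\<in>?I. multiplicity p (b - a))"
    unfolding hook_prod_def using assms(2) finite_inversions[OF finite_ones]
    by (subst prime_elem_multiplicity_prod_distrib)
       (auto simp: inversions_def image_iff case_prod_unfold)
  ultimately show ?le ?eq by (auto simp: syt_exponent_def)
qed

text \<open>A prime factor of the count divides a factorial and is therefore bounded by its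
  argument. Non-primes get the factor 1, so that the product matches a loop through all
  candidates.\<close>

theorem syt_count_prime_powers:
  assumes "maya_valid x"
  shows "maya_syt_count x =
    (\<Prod>p=1..card (inversions (ones x)). if prime p then p ^ syt_exponent x p else 1)"
proof -
  let ?f = "maya_syt_count x" and ?N = "card (inversions (ones x))"
  note f = hook_formula_maya[OF assms]
  have f0: "?f \<noteq> 0" using f by (metis fact_nonzero mult_eq_0_iff)
  have sub: "prime_factors ?f \<subseteq> {p \<in> {1..?N}. prime p}"
  proof
    fix p assume "p \<in> prime_factors ?f"
    then have "prime p" "p dvd ?f * hook_prod (ones x)"
      by (auto simp: in_prime_factors_iff)
    then have p: "prime p" "p dvd fact ?N" unfolding f by simp_all
    then have "p \<le> ?N" by (simp add: prime_dvd_fact_iff)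
    then show "p \<in> {p \<in> {1..?N}. prime p}" using p prime_ge_1_nat by auto
  qed
  have "?f = (\<Prod>p\<in>prime_factors ?f. p ^ multiplicity p ?f)"
    using f0 by (simp add: prime_factorization_nat)
  also have "\<dots> = (\<Prod>p\<in>{p \<in> {1..?N}. prime p}. p ^ multiplicity p ?f)"
    by (rule prod.mono_neutral_left)
      (use sub f0 in \<open>auto simp: in_prime_factors_iff not_dvd_imp_multiplicity_0\<close>)
  also have "\<dots> = (\<Prod>p=1..?N. if prime p then p ^ multiplicity p ?f else 1)"
    by (rule prod.inter_filter) simp
  also have "\<dots> = (\<Prod>p=1..?N. if prime p then p ^ syt_exponent x p else 1)"
    by (rule prod.cong[OF refl]) (simp add: syt_exponent(2)[OF assms])
  finally show ?thesis .
qed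


section \<open>Counter programs on Turing machines\<close>

text \<open>\<open>accepts M x P c n\<close>: all computations from \<open>c\<close> halt and stay within \<open>P\<close>, and exactly \<open>n\<close> of
  them accept.\<close>

inductive accepts :: "('q, 's) ntm \<Rightarrow> bool list \<Rightarrow> (('q, 's) config \<Rightarrow> bool) \<Rightarrow> ('q, 's) config \<Rightarrow> nat \<Rightarrow> bool"
  for M x P where
  halt: "P c \<Longrightarrow> \<nexists>c'. step M x c c' \<Longrightarrow> accepts M x P c (of_bool (state c \<in> accepting M))"
| branch: "P c \<Longrightarrow> finite {c'. step M x c c'} \<Longrightarrow> step M x c c0 \<Longrightarrow>
    (\<And>c'. step M x c c' \<Longrightarrow> accepts M x P c' (g c')) \<Longrightarrow>
    accepts M x P c (\<Sum>c' | step M x c c'. g c')"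

definition accepting_paths_from :: "('q, 's) ntm \<Rightarrow> bool list \<Rightarrow> ('q, 's) config \<Rightarrow> ('q, 's) config list set" where
  "accepting_paths_from M x c = {cs. cs \<noteq> [] \<and> hd cs = c \<and> successively (step M x) cs \<and>
     (\<nexists>c'. step M x (last cs) c') \<and> state (last cs) \<in> accepting M}"

lemma accepting_paths_from_halt:
  assumes "\<nexists>c'. step M x c c'"
  shows "accepting_paths_from M x c = (if state c \<in> accepting M then {[c]} else {})"
proof -
  have "cs = [c]" if "cs \<noteq> []" "hd cs = c" "successively (step M x) cs" for cs
    using that assms by (cases cs rule: remdups_adj.cases) auto
  then have "accepting_paths_from M x c = {cs. cs = [c] \<and> state c \<in> accepting M}"
    unfolding accepting_paths_from_def using assms by (intro Collect_cong iffI) (metis last.simps, simp)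
  then show ?thesis by simp
qed

lemma accepting_paths_from_branch:
  assumes "step M x c c0"
  shows "accepting_paths_from M x c = (#) c ` (\<Union>c'\<in>{c'. step M x c c'}. accepting_paths_from M x c')"
proof (intro equalityI subsetI)
  fix cs assume cs: "cs \<in> accepting_paths_from M x c"
  then obtain ds where ds: "cs = c # ds" by (cases cs) (auto simp: accepting_paths_from_def)
  with cs assms have "ds \<noteq> []" by (auto simp: accepting_paths_from_def)
  then obtain d es where "ds = d # es" by (cases ds) auto
  then show "cs \<in> (#) c ` (\<Union>c'\<in>{c'. step M x c c'}. accepting_paths_from M x c')"
    using cs ds by (auto simp: accepting_paths_from_def)
next
  fix cs assume "cs \<in> (#) c ` (\<Union>c'\<in>{c'. step M x c c'}. accepting_paths_from M x c')"
  then obtain ds c' where ds: "cs = c # ds" "step M x c c'" "ds \<in> accepting_paths_from M x c'" by auto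
  then obtain es where "ds = c' # es" by (cases ds) (auto simp: accepting_paths_from_def)
  then show "cs \<in> accepting_paths_from M x c"
    using ds by (auto simp: accepting_paths_from_def)
qed

lemma accepts_card:
  assumes "accepts M x P c n"
  shows "finite (accepting_paths_from M x c) \<and> card (accepting_paths_from M x c) = n"
  using assms
proof induction
  case (halt c)
  then show ?case by (simp add: accepting_paths_from_halt)
next
  case (branch c c0 g)
  let ?U = "\<Union>c'\<in>{c'. step M x c c'}. accepting_paths_from M x c'"
  \<comment> \<open>Paths from different successors differ in their first configuration, so the
    union is disjoint.\<close>
  have "card ?U = (\<Sum>c' | step M x c c'. card (accepting_paths_from M x c'))"
    by (rule card_UN_disjoint) (use branch in \<open>auto simp: accepting_paths_from_def\<close>)
  moreover have "finite ?U" using branch by auto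
  moreover have "card ((#) c ` ?U) = card ?U" by (rule card_image) simp
  ultimately show ?case
    using branch by (simp add: accepting_paths_from_branch[OF branch.hyps(3)])
qed

text \<open>A derivation of \<open>accepts\<close> is well-founded, and an infinite run from
  \<open>c\<close> yields one from a successor.\<close>

lemma accepts_halts:
  assumes "accepts M x P c n"
  shows "\<not> (\<exists>f :: nat \<Rightarrow> _. f 0 = c \<and> (\<forall>i. step M x (f i) (f (Suc i))))"
  using assms
proof induction
  case (halt c)
  then show ?case by metis
next
  case (branch c c0 g)
  show ?case
  proof
    assume "\<exists>f :: nat \<Rightarrow> _. f 0 = c \<and> (\<forall>i. step M x (f i) (f (Suc i)))"
    then obtain f :: "nat \<Rightarrow> _" where f: "f 0 = c" "\<forall>i. step M x (f i) (f (Suc i))" by blast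
    then have "step M x c (f 1)" by (metis One_nat_def)
    moreover have "\<forall>i. step M x (f (i + 1)) (f (Suc i + 1))" using f by simp
    ultimately show False
      using branch.IH[of "f 1"] by (auto dest: spec[of _ "\<lambda>i. f (i + 1)"])
  qed
qed

lemma accepts_invariant:
  assumes "accepts M x P c n" "cs \<noteq> []" "hd cs = c" "successively (step M x) cs"
  shows "\<forall>d\<in>set cs. P d"
  using assms
proof (induction arbitrary: cs)
  case (halt c)
  then show ?case by (cases cs rule: remdups_adj.cases) auto
next
  case (branch c c0 g)
  show ?case
  proof (cases cs rule: remdups_adj.cases)
    case (3 a b ds)
    then have "\<forall>d\<in>set (b # ds). P d" using branch.prems by (intro branch.IH) auto
    then show ?thesis using branch 3 by auto
  qed (use branch in auto)
qed

lemma accepts_step: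
  assumes "P c" "{c'. step M x c c'} = {d}" "accepts M x P d n"
  shows "accepts M x P c n"
proof -
  have s: "step M x c c' \<longleftrightarrow> c' = d" for c' using assms(2) by blast
  have "accepts M x P c (\<Sum>c' | step M x c c'. n)"
    by (rule accepts.branch[of _ _ _ _ d]) (use assms in \<open>auto simp: s\<close>)
  then show ?thesis by (simp add: s)
qed

text \<open>Paths are sequences of configurations, so counts add up only if the two successors are
  different configurations.\<close>

lemma accepts_step2:
  assumes "P c" "{c'. step M x c c'} = {d, e}" "d \<noteq> e" "accepts M x P d n" "accepts M x P e m"
  shows "accepts M x P c (n + m)"
proof -
  have s: "step M x c c' \<longleftrightarrow> c' = d \<or> c' = e" for c' using assms(2) by blast
  have "accepts M x P c (\<Sum>c' | step M x c c'. if c' = d then n else m)"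
    by (rule accepts.branch[of _ _ _ _ d]) (use assms in \<open>auto simp: s\<close>)
  then show ?thesis using assms(3) by (simp only: assms(2)) simp
qed


section \<open>A counter language and its translation into machines\<close>

datatype reg = Divisor | Remd | Quot | Dividend | Expo | Cells | Cand | Weight | Dist | Ctr

datatype test = NonZero reg | NotLeftEnd | NotRightEnd | IsBit bool

datatype cmd = Skip | Fail | Inc reg | Dec reg | GoLeft | GoRight
  | Seq cmd cmd (infixr ";;" 60) | Cond test cmd cmd | Loop test cmd | Choose cmd cmd

datatype phase = Run | Incr reg | Decr reg | Erase reg | Return reg

primrec idx :: "reg \<Rightarrow> nat" where
  "idx Divisor = 0" | "idx Remd = 1" | "idx Quot = 2" | "idx Dividend = 3" | "idx Expo = 4"
| "idx Cells = 5" | "idx Cand = 6" | "idx Weight = 7" | "idx Dist = 8" | "idx Ctr = 9"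

lemma inj_idx: "inj idx"
proof (rule injI)
  show "v = w" if "idx v = idx w" for v w using that by (cases v; cases w) simp_all
qed

text \<open>The class \<open>sharpL\<close> asks for states of type \<open>nat\<close>, so control
  states must be encodable as numbers.\<close>

instance reg :: countable by (rule countable_classI[of idx]) (rule injD[OF inj_idx])

instance test :: countable by countable_datatype
instance cmd :: countable by countable_datatype
instance phase :: countable by countable_datatype

definition reg_list :: "reg list" where
  "reg_list = [Divisor, Remd, Quot, Dividend, Expo, Cells, Cand, Weight, Dist, Ctr]"

lemma length_reg_list: "length reg_list = 10"
  by (simp add: reg_list_def)

lemma idx_less: "idx v < 10"
  by (cases v) auto

lemma nth_reg_list: "reg_list ! idx v = v"
  by (cases v) (auto simp: reg_list_def)

lemma reg_list_update: "(map f reg_list)[idx v := y] = map (f(v := y)) reg_list"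
  by (cases v) (auto simp: reg_list_def)

fun test_holds :: "test \<Rightarrow> input_symbol \<Rightarrow> nat list \<Rightarrow> bool" where
  "test_holds (NonZero v) a bs \<longleftrightarrow> bs ! idx v \<noteq> 0"
| "test_holds NotLeftEnd a bs \<longleftrightarrow> a \<noteq> Left_End"
| "test_holds NotRightEnd a bs \<longleftrightarrow> a \<noteq> Right_End"
| "test_holds (IsBit b) a bs \<longleftrightarrow> a = Bit b"

definition idle :: "nat list \<Rightarrow> (nat \<times> direction) list" where
  "idle bs = map (\<lambda>b. (b, Stay)) bs"

text \<open>A control state is a stack of commands still to be executed, together with the phase of
  an arithmetic operation under way. Registers hold numbers in bijective base 2 with the
  least significant digit first: every cell holds a digit 1 or 2, or the blank 0 beyond the last digit.
  Therefore a register is zero iff the scanned cell at position 0 is blank, and after an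
  update the head returns to position 0 by searching for the blank at position -1. A borrow turns
  a 1 into a 2; if it runs past the last digit, that digit is erased.\<close>

type_synonym control = "phase \<times> cmd list"

fun run_step :: "cmd list \<Rightarrow> input_symbol \<Rightarrow> nat list \<Rightarrow> (control \<times> direction) set" where
  "run_step [] a bs = {}"
| "run_step (Skip # k) a bs = {((Run, k), Stay)}"
| "run_step (Fail # k) a bs = {}"
| "run_step (Inc v # k) a bs = {((Incr v, k), Stay)}"
| "run_step (Dec v # k) a bs = {((Decr v, k), Stay)}"
| "run_step (GoLeft # k) a bs = {((Run, k), if a = Left_End then Stay else Move_Left)}"
| "run_step (GoRight # k) a bs = {((Run, k), if a = Right_End then Stay else Move_Right)}"
| "run_step ((c ;; d) # k) a bs = {((Run, c # d # k), Stay)}"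
| "run_step (Cond t c d # k) a bs = {((Run, (if test_holds t a bs then c else d) # k), Stay)}"
| "run_step (Loop t c # k) a bs =
    {((Run, if test_holds t a bs then c # Loop t c # k else k), Stay)}"
| "run_step (Choose c d # k) a bs = {((Run, c # k), Stay), ((Run, d # k), Stay)}"

fun digit_step :: "phase \<Rightarrow> nat \<Rightarrow> phase \<times> nat \<times> direction" where
  "digit_step Run b = (Run, b, Stay)"
| "digit_step (Incr v) b =
    (if b = 0 then (Return v, 1, Move_Left) else if b = 1 then (Return v, 2, Move_Left)
     else (Incr v, 1, Move_Right))"
| "digit_step (Decr v) b =
    (if b = 0 then (Erase v, 0, Move_Left) else if b = 1 then (Decr v, 2, Move_Right)
     else (Return v, 1, Move_Left))"
| "digit_step (Erase v) b = (Return v, 0, Move_Left)"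
| "digit_step (Return v) b = (if b = 0 then (Run, 0, Move_Right) else (Return v, b, Move_Left))"

fun active :: "phase \<Rightarrow> reg" where
  "active (Incr v) = v" | "active (Decr v) = v" | "active (Erase v) = v" | "active (Return v) = v"
| "active Run = Divisor"

definition delta :: "control \<Rightarrow> input_symbol \<Rightarrow> nat list \<Rightarrow> (control \<times> direction \<times> (nat \<times> direction) list) set" where
  "delta = (\<lambda>(ph, k) a bs.
     if ph = Run then (\<lambda>(s, d). (s, d, idle bs)) ` run_step k a bs
     else let (ph', b, d) = digit_step ph (bs ! idx (active ph))
       in {((ph', k), Stay, (idle bs)[idx (active ph) := (b, d)])})"

text \<open>A finite bound on the stacks that occur while \<open>c\<close> is executed on top of
  \<open>k\<close>. A loop body runs on top of the loop itself, so iterating does not deepen the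
  stack; this is what makes the state set finite.\<close>

fun conts :: "cmd \<Rightarrow> cmd list \<Rightarrow> cmd list set" where
  "conts (c ;; d) k = {(c ;; d) # k} \<union> conts c (d # k) \<union> conts d k"
| "conts (Cond t c d) k = {Cond t c d # k} \<union> conts c k \<union> conts d k"
| "conts (Loop t c) k = {Loop t c # k} \<union> conts c (Loop t c # k)"
| "conts (Choose c d) k = {Choose c d # k} \<union> conts c k \<union> conts d k"
| "conts c k = {c # k}"

fun next_stacks :: "cmd list \<Rightarrow> cmd list set" where
  "next_stacks [] = {}"
| "next_stacks ((c ;; d) # k) = {c # d # k}"
| "next_stacks (Cond t c d # k) = {c # k, d # k}"
| "next_stacks (Loop t c # k) = {c # Loop t c # k, k}"
| "next_stacks (Choose c d # k) = {c # k, d # k}"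
| "next_stacks (c # k) = {k}"

lemma finite_conts: "finite (conts c k)"
  by (induction c arbitrary: k) auto

lemma Cons_in_conts: "c # k \<in> conts c k"
  by (cases c) auto

lemma next_stacks_conts: "st \<in> conts c k \<Longrightarrow> next_stacks st \<subseteq> insert k (conts c k)"
proof (induction c arbitrary: k)
  case (Seq c d)
  consider "st = (c ;; d) # k" | "st \<in> conts c (d # k)" | "st \<in> conts d k" using Seq.prems by auto
  then show ?case
  proof cases
    case 2
    then show ?thesis using Seq.IH(1)[OF 2] Cons_in_conts[of d k] unfolding conts.simps by blast
  next
    case 3
    then show ?thesis using Seq.IH(2)[OF 3] unfolding conts.simps by blast
  qed (simp add: Cons_in_conts)
next
  case (Cond t c d)
  consider "st = Cond t c d # k" | "st \<in> conts c k" | "st \<in> conts d k" using Cond.prems by auto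
  then show ?case
  proof cases
    case 2
    then show ?thesis using Cond.IH(1)[OF 2] unfolding conts.simps by blast
  next
    case 3
    then show ?thesis using Cond.IH(2)[OF 3] unfolding conts.simps by blast
  qed (simp add: Cons_in_conts)
next
  case (Choose c d)
  consider "st = Choose c d # k" | "st \<in> conts c k" | "st \<in> conts d k" using Choose.prems by auto
  then show ?case
  proof cases
    case 2
    then show ?thesis using Choose.IH(1)[OF 2] unfolding conts.simps by blast
  next
    case 3
    then show ?thesis using Choose.IH(2)[OF 3] unfolding conts.simps by blast
  qed (simp add: Cons_in_conts)
next
  case (Loop t c)
  consider "st = Loop t c # k" | "st \<in> conts c (Loop t c # k)" using Loop.prems by auto
  then show ?case
  proof cases
    case 2
    then show ?thesis using Loop.IH[OF 2] unfolding conts.simps by blast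
  qed (simp add: Cons_in_conts)
qed simp_all

definition controls :: "cmd \<Rightarrow> control set" where
  "controls c = UNIV \<times> insert [] (conts c [])"

lemma finite_reg: "finite (UNIV :: reg set)"
proof (rule finite_subset)
  show "UNIV \<subseteq> set reg_list"
  proof
    show "v \<in> set reg_list" for v by (cases v) (simp_all add: reg_list_def)
  qed
qed simp

lemma finite_phase: "finite (UNIV :: phase set)"
proof (rule finite_subset)
  show "UNIV \<subseteq> insert Run (range Incr \<union> range Decr \<union> range Erase \<union> range Return)"
  proof
    show "ph \<in> insert Run (range Incr \<union> range Decr \<union> range Erase \<union> range Return)" for ph
      by (cases ph) simp_all
  qed
qed (simp add: finite_reg)

lemma finite_controls: "finite (controls c)"
  by (simp add: controls_def finite_conts finite_phase)

lemma start_controls: "(Run, [c]) \<in> controls c" "(Run, []) \<in> controls c"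
  using Cons_in_conts[of c "[]"] by (auto simp: controls_def)

lemma delta_controls:
  assumes "s \<in> controls c" "(s', d, acts) \<in> delta s a bs"
  shows "s' \<in> controls c"
proof -
  obtain ph st ph' st' where s: "s = (ph, st)" "s' = (ph', st')" by (metis surj_pair)
  have "st' = st \<or> st' \<in> next_stacks st"
  proof (cases "ph = Run")
    case True
    then have "((ph', st'), d) \<in> run_step st a bs" using assms(2) by (auto simp: s delta_def)
    then show ?thesis
      by (cases "(st, a, bs)" rule: run_step.cases) (auto split: if_splits)
  qed (use assms(2) in \<open>auto simp: s delta_def split: prod.splits\<close>)
  then show ?thesis
    using assms(1) next_stacks_conts[of st c "[]"] by (auto simp: controls_def s)
qed

lemma delta_actions:
  assumes "set bs \<subseteq> {0, 1, 2}" "length bs = 10" "(s', d, acts) \<in> delta s a bs"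
  shows "fst ` set acts \<subseteq> {0, 1, 2} \<and> length acts = 10 \<and>
    (a = Left_End \<longrightarrow> d \<noteq> Move_Left) \<and> (a = Right_End \<longrightarrow> d \<noteq> Move_Right)"
proof -
  obtain ph st where s: "s = (ph, st)" by (metis surj_pair)
  have idle: "fst ` set (idle bs) \<subseteq> {0, 1, 2}" "length (idle bs) = 10"
    using assms by (auto simp: idle_def)
  show ?thesis
  proof (cases "ph = Run")
    case True
    then obtain s' where "(s', d) \<in> run_step st a bs" "acts = idle bs"
      using assms(3) by (auto simp: s delta_def)
    then show ?thesis using idle
      by (cases "(st, a, bs)" rule: run_step.cases) (auto split: if_splits)
  next
    case False
    obtain ph' b e where e: "digit_step ph (bs ! idx (active ph)) = (ph', b, e)" by (metis surj_pair)
    have "bs ! idx (active ph) \<in> set bs" using assms(2) idx_less[of "active ph"] by simp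
    then have "bs ! idx (active ph) \<in> {0, 1, 2}" using assms(1) by blast
    then have "b \<in> {0, 1, 2}" using e by (cases ph) (auto split: if_splits)
    then have "fst ` insert (b, e) (set (idle bs)) \<subseteq> {0, 1, 2}" using idle(1) by simp
    moreover have acts: "d = Stay" "acts = (idle bs)[idx (active ph) := (b, e)]"
      using False assms(3) e unfolding s delta_def by simp_all
    have "set acts \<subseteq> insert (b, e) (set (idle bs))"
      unfolding acts(2) by (rule set_update_subset_insert)
    then have "fst ` set acts \<subseteq> fst ` insert (b, e) (set (idle bs))" by (rule image_mono)
    ultimately have "fst ` set acts \<subseteq> {0, 1, 2}" by (rule subset_trans[rotated])
    then show ?thesis using acts idle(2) by simp
  qed
qed

text \<open>The machine halts at an empty stack and at a leading \<open>Fail\<close>, but only the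
  empty stack is an accepting state.\<close>

definition machine :: "cmd \<Rightarrow> (nat, nat) ntm" where
  "machine c = \<lparr>states = to_nat ` controls c, alphabet = {0, 1, 2}, blank = 0, work_tapes = 10,
     start = to_nat (Run, [c]), accepting = {to_nat (Run, [] :: cmd list)},
     trans = \<lambda>q a bs. apfst to_nat ` delta (from_nat q) a bs\<rparr>"

lemma machine_simps:
  "states (machine c) = to_nat ` controls c" "alphabet (machine c) = {0, 1, 2}"
  "blank (machine c) = 0" "work_tapes (machine c) = 10" "start (machine c) = to_nat (Run, [c])"
  "accepting (machine c) = {to_nat (Run, [] :: cmd list)}"
  "trans (machine c) q a bs = apfst to_nat ` delta (from_nat q) a bs"
  by (simp_all add: machine_def)

lemma wf_machine: "wf_ntm (machine c)"
  unfolding wf_ntm_def machine_simps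
proof (intro conjI ballI allI impI)
  fix q a bs act
  assume q: "q \<in> to_nat ` controls c" and bs: "set bs \<subseteq> {0, 1, 2} \<and> length bs = 10"
    and act: "act \<in> apfst to_nat ` delta (from_nat q) a bs"
  obtain s where s: "q = to_nat s" "s \<in> controls c" using q by blast
  obtain t where t: "act = apfst to_nat t" "t \<in> delta s a bs" using act unfolding s(1) by auto
  obtain s' d acts where s': "t = (s', d, acts)" by (metis surj_pair)
  have s'c: "s' \<in> controls c" by (rule delta_controls[OF s(2) t(2)[unfolded s']])
  have "act = (to_nat s', d, acts)" unfolding t(1) s' by simp
  moreover note conjI[OF imageI[OF s'c]
      delta_actions[OF conjunct1[OF bs] conjunct2[OF bs] t(2)[unfolded s']], of to_nat]
  ultimately show "case act of (q', d, acts) \<Rightarrow>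
      q' \<in> to_nat ` controls c \<and> fst ` set acts \<subseteq> {0, 1, 2} \<and> length acts = 10 \<and>
      (a = Left_End \<longrightarrow> d \<noteq> Move_Left) \<and> (a = Right_End \<longrightarrow> d \<noteq> Move_Right)"
    by simp
next
  show "finite (to_nat ` controls c)" by (intro finite_imageI finite_controls)
  show "to_nat (Run, [c]) \<in> to_nat ` controls c" by (intro imageI start_controls)
  show "{to_nat (Run, [] :: cmd list)} \<subseteq> to_nat ` controls c" by (simp add: start_controls)
qed simp_all

section \<open>Bijective binary numerals on a work tape\<close>

fun incr :: "nat list \<Rightarrow> nat list" where
  "incr [] = [1]"
| "incr (d # ds) = (if d = 1 then 2 # ds else 1 # incr ds)"

fun decr :: "nat list \<Rightarrow> nat list" where
  "decr [] = []"
| "decr (d # ds) = (if d = 2 then 1 # ds else if ds = [] then [] else 2 # decr ds)"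

definition digits :: "nat \<Rightarrow> nat list" where
  "digits v = (incr ^^ v) []"

lemma digits_0 [simp]: "digits 0 = []"
  by (simp add: digits_def)

lemma digits_Suc: "digits (Suc v) = incr (digits v)"
  by (simp add: digits_def)

lemma set_incr: "set ds \<subseteq> {1, 2} \<Longrightarrow> set (incr ds) \<subseteq> {1, 2}"
  by (induction ds) auto

lemma set_digits: "set (digits v) \<subseteq> {1, 2}"
proof (induction v)
  case (Suc v)
  then show ?case by (simp only: digits_Suc set_incr)
qed simp

lemma incr_neq_Nil [simp]: "incr ds \<noteq> []"
  by (cases ds) auto

lemma decr_incr: "set ds \<subseteq> {1, 2} \<Longrightarrow> decr (incr ds) = ds"
  by (induction ds) auto

lemma decr_digits: "decr (digits (Suc v)) = digits v"
  using decr_incr[OF set_digits] by (simp add: digits_Suc)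

lemma digits_eq_Nil_iff [simp]: "digits v = [] \<longleftrightarrow> v = 0"
  by (cases v) (auto simp: digits_Suc)

text \<open>Every digit is at least 1, so a numeral of length \<open>k\<close> has value at least
  \<open>2 ^ k - 1\<close>.\<close>

lemma length_digits: "2 ^ length (digits v) \<le> Suc v"
proof -
  define val :: "nat list \<Rightarrow> nat \<Rightarrow> nat" where "val = foldr (\<lambda>d n. d + 2 * n)"
  have incr: "val (incr ds) 0 = Suc (val ds 0)" if "set ds \<subseteq> {1, 2}" for ds
    using that by (induction ds) (auto simp: val_def)
  have "val (digits v) 0 = v"
    by (induction v) (simp_all add: digits_Suc incr[OF set_digits], simp add: val_def)
  moreover have "2 ^ length ds \<le> Suc (val ds 0)" if "set ds \<subseteq> {1, 2}" for ds
    using that by (induction ds) (auto simp: val_def)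
  ultimately show ?thesis using set_digits by metis
qed

lemma length_digits_le: "v < 2 ^ L \<Longrightarrow> length (digits v) \<le> L"
  using length_digits[of v] by (metis Suc_leI le_trans one_less_numeral_iff power_le_imp_le_exp semiring_norm(76))

definition tape :: "nat list \<Rightarrow> int \<Rightarrow> nat" where
  "tape ds j = (if 0 \<le> j \<and> nat j < length ds then ds ! nat j else 0)"

lemma tape_append_Cons: "tape (ds @ d # es) (int (length ds)) = d"
  by (simp add: tape_def)

lemma tape_end: "tape ds (int (length ds)) = 0"
  by (simp add: tape_def)

lemma tape_update: "(tape (ds @ d # es))(int (length ds) := e) = tape (ds @ e # es)"
  by (rule ext) (auto simp: tape_def nth_append nth_Cons split: nat.split)

lemma tape_extend: "(tape ds)(int (length ds) := d) = tape (ds @ [d])"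
  by (rule ext) (auto simp: tape_def nth_append)

lemma tape_erase: "(tape (ds @ [d]))(int (length ds) := 0) = tape ds"
  by (rule ext) (auto simp: tape_def nth_append)

definition conf :: "control \<Rightarrow> int \<Rightarrow> ((int \<Rightarrow> nat) \<times> int) list \<Rightarrow> (nat, nat) config" where
  "conf s h ws = \<lparr>state = to_nat s, input_head = h, work = ws\<rparr>"

lemma step_machine:
  "step (machine c) x (conf s h ws) c' \<longleftrightarrow>
    (\<exists>(s', d, acts) \<in> delta s (input_at x h) (map scan ws). c' = conf s' (h + shift d) (map2 act acts ws))"
  unfolding step_def conf_def machine_def by (simp add: case_prod_unfold)

lemma act_idle: "map2 act (idle (map scan ws)) ws = ws"
  by (induction ws) (auto simp: idle_def act_def scan_def split: prod.split)

lemma act_update: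
  "i < length ws \<Longrightarrow> map2 act ((idle (map scan ws))[i := a]) ws = ws[i := act a (ws ! i)]"
  by (rule nth_equalityI)
    (auto simp: idle_def nth_list_update act_def scan_def split: prod.split)

definition tapes :: "(reg \<Rightarrow> nat) \<Rightarrow> ((int \<Rightarrow> nat) \<times> int) list" where
  "tapes r = map (\<lambda>v. (tape (digits (r v)), 0)) reg_list"

lemma length_tapes [simp]: "length (tapes r) = 10"
  by (simp add: tapes_def length_reg_list)

lemma nth_tapes: "tapes r ! idx v = (tape (digits (r v)), 0)"
  by (simp add: tapes_def length_reg_list idx_less nth_reg_list)

lemma tapes_update: "(tapes r)[idx v := (tape (digits n), 0)] = tapes (r(v := n))"
  unfolding tapes_def reg_list_update by (rule map_cong) auto

section \<open>Path-counting rules for commands\<close>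

locale space_bound =
  fixes prog :: cmd and x :: "bool list" and L :: nat
begin

text \<open>Numerals of length at most \<open>L\<close> occupy cells \<open>0\<close> to
  \<open>L - 1\<close>. Cell \<open>-1\<close> is the blank that ends the way back, and cell
  \<open>L\<close> is where a borrow notices that a full numeral has ended.\<close>

definition in_space :: "(nat, nat) config \<Rightarrow> bool" where
  "in_space c \<longleftrightarrow> length (work c) = 10 \<and> (\<forall>w \<in> set (work c). snd w \<in> {-1..int L})"

text \<open>The transition function is the same for all programs; \<open>prog\<close> only fixes the
  start state and the set of states. Hence the rules hold for arbitrary commands and stacks.\<close>

abbreviation counts :: "control \<Rightarrow> int \<Rightarrow> ((int \<Rightarrow> nat) \<times> int) list \<Rightarrow> nat \<Rightarrow> bool" where
  "counts s h ws n \<equiv> accepts (machine prog) x in_space (conf s h ws) n"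

lemma in_space_tapes: "in_space (conf s h (tapes r))"
  by (auto simp: in_space_def conf_def tapes_def length_reg_list)

lemma in_space_update:
  assumes "in_space (conf s h ws)" "-1 \<le> p" "p \<le> int L"
  shows "in_space (conf s' h' (ws[idx v := (t, p)]))"
proof -
  have "set (ws[idx v := (t, p)]) \<subseteq> insert (t, p) (set ws)" by (rule set_update_subset_insert)
  then show ?thesis using assms by (auto simp: in_space_def conf_def)
qed

lemma counts_run:
  assumes "in_space (conf s h ws)" "run_step k (input_at x h) (map scan ws) = {(s', d)}"
    "counts s' (h + shift d) ws n"
  shows "counts (Run, k) h ws n"
proof (rule accepts_step)
  show "in_space (conf (Run, k) h ws)" using assms(1) by (simp add: in_space_def conf_def)
  show "{c'. step (machine prog) x (conf (Run, k) h ws) c'} = {conf s' (h + shift d) ws}"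
    by (auto simp: step_machine delta_def assms(2) act_idle)
qed fact

lemma counts_digit:
  assumes "in_space (conf s h ws)" "ph \<noteq> Run" "v = active ph" "-1 \<le> p" "p \<le> int L"
    "digit_step ph (t p) = (ph', b, d)"
    "counts (ph', k) h (ws[idx v := (t(p := b), p + shift d)]) n"
  shows "counts (ph, k) h (ws[idx v := (t, p)]) n"
proof (rule accepts_step)
  let ?ws = "ws[idx v := (t, p)]"
  show "in_space (conf (ph, k) h ?ws)" by (rule in_space_update[OF assms(1,4,5)])
  have len: "idx v < length ws" using assms(1) idx_less by (simp add: in_space_def conf_def)
  then have "map scan ?ws ! idx v = t p" by (simp add: scan_def)
  moreover have "map2 act ((idle (map scan ?ws))[idx v := (b, d)]) ?ws =
      ws[idx v := (t(p := b), p + shift d)]"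
    using len by (subst act_update) (auto simp: act_def)
  ultimately show "{c'. step (machine prog) x (conf (ph, k) h ?ws) c'} =
      {conf (ph', k) h (ws[idx v := (t(p := b), p + shift d)])}"
    using assms(2,3,6) by (auto simp: step_machine delta_def)
qed fact

text \<open>Digits are never 0, so the search to the left cannot stop before cell
  \<open>-1\<close>.\<close>

lemma counts_Return:
  assumes "in_space (conf s h ws)" "set ds \<subseteq> {1, 2}" "length ds \<le> L" "p < int (length ds)" "-1 \<le> p"
    "counts (Run, k) h (ws[idx v := (tape ds, 0)]) n"
  shows "counts (Return v, k) h (ws[idx v := (tape ds, p)]) n"
  using assms(4,5)
proof (induction "nat (p + 1)" arbitrary: p)
  case 0
  then have p: "p = -1" by simp
  have ih: "tape ds (-1) = 0" "(tape ds)(-1 := 0) = tape ds" by (auto simp: tape_def)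
  show ?case
    unfolding p by (rule counts_digit[OF assms(1), where ph' = Run and b = 0 and d = Move_Right])
      (use ih assms(6) in simp_all)
next
  case (Suc m)
  then have p: "0 \<le> p" "nat p < length ds" by auto
  then have "ds ! nat p \<in> {1, 2}" using assms(2) nth_mem by blast
  then have t: "tape ds p \<noteq> 0" using p by (auto simp: tape_def)
  have ih: "counts (Return v, k) h (ws[idx v := (tape ds, p - 1)]) n"
    by (rule Suc.hyps(1)) (use Suc.hyps(2) Suc.prems p in linarith)+
  show ?case
    by (rule counts_digit[OF assms(1), where ph' = "Return v" and b = "tape ds p" and d = Move_Left])
      (use ih assms(3) p t Suc.prems in simp_all)
qed

text \<open>For the induction the numeral is split at the head: \<open>pre\<close> has been
  processed, and the carry is about to enter \<open>suf\<close>.\<close>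

lemma counts_Incr:
  assumes "in_space (conf s h ws)" "set (pre @ suf) \<subseteq> {1, 2}" "length (pre @ incr suf) \<le> L"
    "counts (Run, k) h (ws[idx v := (tape (pre @ incr suf), 0)]) n"
  shows "counts (Incr v, k) h (ws[idx v := (tape (pre @ suf), int (length pre))]) n"
  using assms(2-)
proof (induction suf arbitrary: pre)
  case Nil
  have ih: "counts (Return v, k) h (ws[idx v := (tape (pre @ [1]), int (length pre) - 1)]) n"
    by (rule counts_Return[OF assms(1)]) (use Nil in simp_all)
  show ?case
    by (rule counts_digit[OF assms(1), where ph' = "Return v" and b = 1 and d = Move_Left])
      (use ih Nil in \<open>simp_all add: tape_end tape_extend\<close>)
next
  case (Cons d ds)
  show ?case
  proof (cases "d = 1")
    case True
    have ih: "counts (Return v, k) h (ws[idx v := (tape (pre @ 2 # ds), int (length pre) - 1)]) n"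
      by (rule counts_Return[OF assms(1)]) (use Cons.prems True in simp_all)
    show ?thesis
      by (rule counts_digit[OF assms(1), where ph' = "Return v" and b = 2 and d = Move_Left])
        (use ih Cons.prems True in \<open>simp_all add: tape_append_Cons tape_update\<close>)
  next
    case False
    then have "d = 2" using Cons.prems by auto
    have ih: "counts (Incr v, k) h (ws[idx v := (tape ((pre @ [1]) @ ds), int (length (pre @ [1])))]) n"
      by (rule Cons.IH) (use Cons.prems \<open>d = 2\<close> in simp_all)
    show ?thesis
      by (rule counts_digit[OF assms(1), where ph' = "Incr v" and b = 1 and d = Move_Right])
        (use ih Cons.prems \<open>d = 2\<close> in \<open>simp_all add: tape_append_Cons tape_update add.commute\<close>)
  qed
qed

lemma counts_Decr:
  assumes "in_space (conf s h ws)" "suf \<noteq> []" "set (pre @ suf) \<subseteq> {1, 2}" "length (pre @ suf) \<le> L"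
    "counts (Run, k) h (ws[idx v := (tape (pre @ decr suf), 0)]) n"
  shows "counts (Decr v, k) h (ws[idx v := (tape (pre @ suf), int (length pre))]) n"
  using assms(2-)
proof (induction suf arbitrary: pre)
  case (Cons d ds)
  consider "d = 2" | "d = 1" "ds = []" | "d = 1" "ds \<noteq> []" using Cons.prems by auto
  then show ?case
  proof cases
    case 1
    have ih: "counts (Return v, k) h (ws[idx v := (tape (pre @ 1 # ds), int (length pre) - 1)]) n"
      by (rule counts_Return[OF assms(1)]) (use Cons.prems 1 in simp_all)
    show ?thesis
      by (rule counts_digit[OF assms(1), where ph' = "Return v" and b = 1 and d = Move_Left])
        (use ih Cons.prems 1 in \<open>simp_all add: tape_append_Cons tape_update\<close>)
  next
    case 2
    \<comment> \<open>The run is assembled backwards: the last digit 1 becomes 2, the head finds the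
      blank beyond it, steps back and erases the 2.\<close>
    have ih: "counts (Return v, k) h (ws[idx v := (tape pre, int (length pre) - 1)]) n"
      by (rule counts_Return[OF assms(1)]) (use Cons.prems 2 in simp_all)
    have ih: "counts (Erase v, k) h (ws[idx v := (tape (pre @ [2]), int (length pre))]) n"
      by (rule counts_digit[OF assms(1), where ph' = "Return v" and b = 0 and d = Move_Left])
        (use ih Cons.prems 2 in \<open>simp_all add: tape_erase\<close>)
    have t: "tape (pre @ [2]) (int (length pre) + 1) = 0"
      "(tape (pre @ [2]))(int (length pre) + 1 := 0) = tape (pre @ [2])"
      by (auto simp: tape_def fun_eq_iff)
    have ih: "counts (Decr v, k) h (ws[idx v := (tape (pre @ [2]), int (length pre) + 1)]) n"
      by (rule counts_digit[OF assms(1), where ph' = "Erase v" and b = 0 and d = Move_Left])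
        (use ih t Cons.prems 2 in simp_all)
    show ?thesis
      by (rule counts_digit[OF assms(1), where ph' = "Decr v" and b = 2 and d = Move_Right])
        (use ih Cons.prems 2 in \<open>simp_all add: tape_append_Cons tape_update\<close>)
  next
    case 3
    have ih: "counts (Decr v, k) h (ws[idx v := (tape ((pre @ [2]) @ ds), int (length (pre @ [2])))]) n"
      by (rule Cons.IH) (use Cons.prems 3 in simp_all)
    show ?thesis
      by (rule counts_digit[OF assms(1), where ph' = "Decr v" and b = 2 and d = Move_Right])
        (use ih Cons.prems 3 in \<open>simp_all add: tape_append_Cons tape_update add.commute\<close>)
  qed
qed simp

text \<open>The command \<open>c\<close> leads from registers \<open>r\<close> and head position \<open>h\<close> to \<open>r'\<close> and \<open>h'\<close> along \<open>m\<close> paths,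
  whatever is executed afterwards. All these paths have to end in the same state.\<close>

definition runs :: "cmd \<Rightarrow> (reg \<Rightarrow> nat) \<Rightarrow> int \<Rightarrow> nat \<Rightarrow> (reg \<Rightarrow> nat) \<Rightarrow> int \<Rightarrow> bool" where
  "runs c r h m r' h' \<longleftrightarrow>
     (\<forall>k n. counts (Run, k) h' (tapes r') n \<longrightarrow> counts (Run, c # k) h (tapes r) (m * n))"

definition rejects :: "cmd \<Rightarrow> (reg \<Rightarrow> nat) \<Rightarrow> int \<Rightarrow> bool" where
  "rejects c r h \<longleftrightarrow> (\<forall>k. counts (Run, c # k) h (tapes r) 0)"

definition holds :: "test \<Rightarrow> (reg \<Rightarrow> nat) \<Rightarrow> int \<Rightarrow> bool" where
  "holds t r h \<longleftrightarrow> test_holds t (input_at x h) (map scan (tapes r))"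

lemma scan_tapes: "map scan (tapes r) ! idx v \<noteq> 0 \<longleftrightarrow> r v \<noteq> 0"
proof -
  have "map scan (tapes r) ! idx v = tape (digits (r v)) 0"
    using idx_less[of v] by (simp add: nth_tapes scan_def)
  moreover have "tape (digits (r v)) 0 \<noteq> 0 \<longleftrightarrow> r v \<noteq> 0"
    using set_digits[of "r v"] digits_eq_Nil_iff[of "r v"]
    by (cases "digits (r v)") (auto simp: tape_def simp del: digits_eq_Nil_iff)
  ultimately show ?thesis by simp
qed

lemma holds_simps [simp]:
  "holds (NonZero v) r h \<longleftrightarrow> r v \<noteq> 0"
  "holds NotLeftEnd r h \<longleftrightarrow> 0 < h"
  "holds NotRightEnd r h \<longleftrightarrow> h \<le> int (length x)"
  "holds (IsBit b) r h \<longleftrightarrow> 0 < h \<and> h \<le> int (length x) \<and> x ! nat (h - 1) = b"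
  using scan_tapes by (auto simp: holds_def input_at_def)

lemma runs_run_step:
  assumes "\<And>k. run_step (c # k) (input_at x h) (map scan (tapes r)) = {((Run, f k), d)}"
    "\<And>k n. counts (Run, k) h' (tapes r') n \<Longrightarrow> counts (Run, f k) (h + shift d) (tapes r) (m * n)"
  shows "runs c r h m r' h'"
  unfolding runs_def
proof (intro allI impI)
  fix k n assume "counts (Run, k) h' (tapes r') n"
  from assms(2)[OF this] show "counts (Run, c # k) h (tapes r) (m * n)"
    by (rule counts_run[OF in_space_tapes assms(1)])
qed

lemma runs_Skip: "runs Skip r h 1 r h"
  by (rule runs_run_step) auto

lemma runs_GoLeft: "0 < h \<Longrightarrow> runs GoLeft r h 1 r (h - 1)"
  by (rule runs_run_step) (auto simp: input_at_def)

lemma runs_GoRight: "h \<le> int (length x) \<Longrightarrow> runs GoRight r h 1 r (h + 1)"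
  by (rule runs_run_step) (auto simp: input_at_def)

lemma runs_Seq:
  assumes "runs c r h m r1 h1" "runs d r1 h1 m' r2 h2"
  shows "runs (c ;; d) r h (m * m') r2 h2"
  by (rule runs_run_step[where f = "\<lambda>k. c # d # k"]) (use assms in \<open>auto simp: runs_def mult.assoc\<close>)

lemma runs_Cond:
  assumes "runs (if holds t r h then c else d) r h m r' h'"
  shows "runs (Cond t c d) r h m r' h'"
  by (rule runs_run_step[where f = "\<lambda>k. (if holds t r h then c else d) # k"])
    (use assms in \<open>auto simp: runs_def holds_def\<close>)

lemma runs_Loop_exit: "\<not> holds t r h \<Longrightarrow> runs (Loop t c) r h 1 r h"
  by (rule runs_run_step[where f = "\<lambda>k. k"]) (auto simp: runs_def holds_def)

lemma runs_Loop_step: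
  assumes "holds t r h" "runs c r h m r1 h1" "runs (Loop t c) r1 h1 m' r2 h2"
  shows "runs (Loop t c) r h (m * m') r2 h2"
  by (rule runs_run_step[where f = "\<lambda>k. c # Loop t c # k"])
    (use assms in \<open>auto simp: runs_def holds_def mult.assoc\<close>)

lemma runs_Loop:
  assumes "\<And>i. i < n \<Longrightarrow> holds t (R i) (H i)"
    and "\<And>i. i < n \<Longrightarrow> runs c (R i) (H i) (m i) (R (Suc i)) (H (Suc i))"
    and "\<not> holds t (R n) (H n)"
  shows "runs (Loop t c) (R 0) (H 0) (\<Prod>i<n. m i) (R n) (H n)"
proof -
  have "runs (Loop t c) (R i) (H i) (\<Prod>j=i..<n. m j) (R n) (H n)" if "i \<le> n" for i
    using that
  proof (induction rule: inc_induct)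
    case base
    then show ?case using runs_Loop_exit[OF assms(3)] by simp
  next
    case (step i)
    then show ?case
      using runs_Loop_step[OF assms(1,2) step.IH] by (simp add: prod.atLeast_Suc_lessThan)
  qed
  from this[of 0] show ?thesis by (simp add: atLeast0LessThan)
qed

lemma runs_Inc:
  assumes "r v + 1 < 2 ^ L"
  shows "runs (Inc v) r h 1 (r(v := r v + 1)) h"
  unfolding runs_def
proof (intro allI impI)
  fix k n assume "counts (Run, k) h (tapes (r(v := r v + 1))) n"
  then have "counts (Run, k) h ((tapes r)[idx v := (tape (incr (digits (r v))), 0)]) n"
    by (simp add: tapes_update flip: digits_Suc)
  then have "counts (Incr v, k) h ((tapes r)[idx v := (tape (digits (r v)), 0)]) n"
    using set_digits[of "r v"] length_digits_le[OF assms] assms(1)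
    by (intro counts_Incr[OF in_space_tapes, where pre = "[]", unfolded append_Nil list.size of_nat_0])
      (simp_all flip: digits_Suc)
  then have *: "counts (Incr v, k) h (tapes r) n"
    using tapes_update[of r v "r v"] by simp
  show "counts (Run, Inc v # k) h (tapes r) (1 * n)"
    by (rule counts_run[OF in_space_tapes, where s' = "(Incr v, k)" and d = Stay]) (use * in simp_all)
qed

lemma runs_Dec:
  assumes "0 < r v" "r v < 2 ^ L"
  shows "runs (Dec v) r h 1 (r(v := r v - 1)) h"
  unfolding runs_def
proof (intro allI impI)
  fix k n assume "counts (Run, k) h (tapes (r(v := r v - 1))) n"
  moreover have "digits (r v - 1) = decr (digits (r v))"
    using decr_digits[of "r v - 1"] assms(1) by simp
  ultimately have "counts (Run, k) h ((tapes r)[idx v := (tape (decr (digits (r v))), 0)]) n"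
    using tapes_update[of r v "r v - 1"] by simp
  then have "counts (Decr v, k) h ((tapes r)[idx v := (tape (digits (r v)), 0)]) n"
    using set_digits[of "r v"] length_digits_le[OF assms(2)] assms(1)
    by (intro counts_Decr[OF in_space_tapes, where pre = "[]", unfolded append_Nil list.size of_nat_0])
      (simp_all flip: digits_Suc)
  then have *: "counts (Decr v, k) h (tapes r) n"
    using tapes_update[of r v "r v"] by simp
  show "counts (Run, Dec v # k) h (tapes r) (1 * n)"
    by (rule counts_run[OF in_space_tapes, where s' = "(Decr v, k)" and d = Stay]) (use * in simp_all)
qed

lemma counts_Choose:
  assumes "counts (Run, c # k) h (tapes r) n" "counts (Run, d # k) h (tapes r) m" "c \<noteq> d"
  shows "counts (Run, Choose c d # k) h (tapes r) (n + m)"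
proof (rule accepts_step2)
  show "{c'. step (machine prog) x (conf (Run, Choose c d # k) h (tapes r)) c'} =
      {conf (Run, c # k) h (tapes r), conf (Run, d # k) h (tapes r)}"
    by (auto simp: step_machine delta_def act_idle)
  show "conf (Run, c # k) h (tapes r) \<noteq> conf (Run, d # k) h (tapes r)"
    using assms(3) by (simp add: conf_def)
qed (use assms in_space_tapes in auto)

lemma rejects_Fail: "rejects Fail r h"
  unfolding rejects_def
proof
  fix k
  have "\<nexists>c'. step (machine prog) x (conf (Run, Fail # k) h (tapes r)) c'"
    by (simp add: step_machine delta_def)
  from accepts.halt[of in_space, OF in_space_tapes this]
  show "counts (Run, Fail # k) h (tapes r) 0"
    by (simp add: conf_def machine_simps)
qed

text \<open>The two branches may leave different registers and agree only after the rest of the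
  loop, so \<open>Choose\<close> is treated together with the remaining iterations. The condition
  \<open>c \<noteq> d\<close> makes the successor stacks different.\<close>

lemma runs_Loop_Choose:
  assumes "holds t r h" "runs a r h 1 r1 h1" "c \<noteq> d"
    and "runs c r1 h1 m r2 h2" "runs (Loop t (a ;; Choose c d)) r2 h2 m' r' h'"
    and "runs d r1 h1 n r3 h3" "runs (Loop t (a ;; Choose c d)) r3 h3 n' r' h'"
  shows "runs (Loop t (a ;; Choose c d)) r h (m * m' + n * n') r' h'"
proof (rule runs_run_step[where f = "\<lambda>k. (a ;; Choose c d) # Loop t (a ;; Choose c d) # k"])
  fix k N assume N: "counts (Run, k) h' (tapes r') N"
  let ?k = "Loop t (a ;; Choose c d) # k"
  have "counts (Run, c # ?k) h1 (tapes r1) (m * (m' * N))"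
    using N assms(4,5) by (simp add: runs_def)
  moreover have "counts (Run, d # ?k) h1 (tapes r1) (n * (n' * N))"
    using N assms(6,7) by (simp add: runs_def)
  ultimately have *: "counts (Run, Choose c d # ?k) h1 (tapes r1) (m * (m' * N) + n * (n' * N))"
    using assms(3) by (rule counts_Choose)
  then have *: "counts (Run, a # Choose c d # ?k) h (tapes r) (m * (m' * N) + n * (n' * N))"
    using assms(2) by (simp add: runs_def)
  have "counts (Run, (a ;; Choose c d) # ?k) h (tapes r) (m * (m' * N) + n * (n' * N))"
    by (rule counts_run[OF in_space_tapes, where s' = "(Run, a # Choose c d # ?k)" and d = Stay])
      (use * in simp_all)
  then show "counts (Run, (a ;; Choose c d) # ?k) (h + shift Stay) (tapes r) ((m * m' + n * n') * N)"
    by (simp add: algebra_simps)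
qed (use assms(1) in \<open>simp add: holds_def\<close>)

lemma rejects_Seq1:
  assumes "rejects c r h"
  shows "rejects (c ;; d) r h"
  unfolding rejects_def
proof
  fix k
  show "counts (Run, (c ;; d) # k) h (tapes r) 0"
    by (rule counts_run[OF in_space_tapes, where s' = "(Run, c # d # k)" and d = Stay])
      (use assms in \<open>simp_all add: rejects_def\<close>)
qed

lemma rejects_Seq2:
  assumes "runs c r h m r1 h1" "rejects d r1 h1"
  shows "rejects (c ;; d) r h"
  unfolding rejects_def
proof
  fix k
  have *: "counts (Run, c # d # k) h (tapes r) (m * 0)"
    using assms unfolding runs_def rejects_def by blast
  show "counts (Run, (c ;; d) # k) h (tapes r) 0"
    by (rule counts_run[OF in_space_tapes, where s' = "(Run, c # d # k)" and d = Stay])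
      (use * in simp_all)
qed

lemma rejects_Cond:
  assumes "rejects (if holds t r h then c else d) r h"
  shows "rejects (Cond t c d) r h"
  unfolding rejects_def
proof
  fix k
  show "counts (Run, Cond t c d # k) h (tapes r) 0"
    by (rule counts_run[OF in_space_tapes,
        where s' = "(Run, (if holds t r h then c else d) # k)" and d = Stay])
      (use assms in \<open>simp_all add: rejects_def holds_def\<close>)
qed

end

lemma initial_machine: "initial (machine c) = conf (Run, [c]) 1 (tapes (\<lambda>_. 0))"
proof -
  have "tape [] = (\<lambda>_. 0)" by (auto simp: tape_def)
  then show ?thesis
    by (simp add: initial_def machine_simps conf_def tapes_def reg_list_def numeral_eq_Suc)
qed

text \<open>One derivation of \<open>accepts\<close> yields halting, the space bound and the path
  count. Each of the 10 heads stays in \<open>{-1..L}\<close>, which are \<open>L + 2\<close>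
  cells.\<close>

theorem sharpL_machine:
  assumes L: "(\<lambda>n. real (10 * (L n + 2))) \<in> O(\<lambda>n. ln (real n))"
    and prog: "\<And>x. space_bound.rejects prog x (L (length x)) prog (\<lambda>_. 0) 1 \<and> f x = 0 \<or>
      (\<exists>r h. space_bound.runs prog x (L (length x)) prog (\<lambda>_. 0) 1 (f x) r h)"
  shows "f \<in> sharpL"
proof -
  let ?M = "machine prog"
  have acc: "accepts ?M x (space_bound.in_space (L (length x))) (initial ?M) (f x)" for x
  proof -
    interpret space_bound prog x "L (length x)" .
    have "counts (Run, [prog]) 1 (tapes (\<lambda>_. 0)) (f x)"
      using prog[of x]
    proof (elim disjE exE conjE)
      fix r h assume run: "runs prog (\<lambda>_. 0) 1 (f x) r h"
      \<comment> \<open>An empty stack accepts along exactly one path, so the factor in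
        \<open>runs\<close> becomes the total count.\<close>
      have "\<nexists>c'. step ?M x (conf (Run, []) h (tapes r)) c'"
        by (simp add: step_machine delta_def)
      from accepts.halt[of in_space, OF in_space_tapes this]
      have "counts (Run, []) h (tapes r) 1" by (simp add: conf_def machine_simps)
      then have "counts (Run, [prog]) 1 (tapes (\<lambda>_. 0)) (f x * 1)"
        using run unfolding runs_def by blast
      then show ?thesis by simp
    qed (simp add: rejects_def)
    then show ?thesis by (simp add: initial_machine)
  qed
  have "log_space ?M"
    unfolding log_space_def
  proof (intro exI conjI allI impI)
    show "(\<lambda>n. real (10 * (L n + 2))) \<in> O(\<lambda>n. ln (real n))" by (rule L)
    fix x cs assume cs: "partial_path ?M x cs"
    interpret space_bound prog x "L (length x)" .
    have in_space: "in_space c" if "c \<in> set cs" for c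
      using accepts_invariant[OF acc[of x], of cs] cs that by (auto simp: partial_path_def)
    have "card ((\<lambda>c. snd (work c ! t)) ` set cs) \<le> L (length x) + 2" if "t < 10" for t
    proof -
      have "(\<lambda>c. snd (work c ! t)) ` set cs \<subseteq> {-1..int (L (length x))}"
      proof (rule image_subsetI)
        fix c assume "c \<in> set cs"
        then have "in_space c" by (rule in_space)
        then show "snd (work c ! t) \<in> {-1..int (L (length x))}"
          using that unfolding in_space_def by (metis nth_mem)
      qed
      then have "card ((\<lambda>c. snd (work c ! t)) ` set cs) \<le> card {-1..int (L (length x))}"
        by (intro card_mono) auto
      then show ?thesis by simp
    qed
    then have "(\<Sum>t<10. card ((\<lambda>c. snd (work c ! t)) ` set cs)) \<le> (\<Sum>t<(10::nat). L (length x) + 2)"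
      by (intro sum_mono) simp
    then show "path_space ?M cs \<le> 10 * (L (length x) + 2)"
      by (simp add: path_space_def machine_simps)
  qed
  moreover have "halts_on_all_paths ?M x" for x
    using accepts_halts[OF acc] by (simp add: halts_on_all_paths_def)
  moreover have "f x = card {cs. accepting_path ?M x cs}" for x
  proof -
    have "{cs. accepting_path ?M x cs} = accepting_paths_from ?M x (initial ?M)"
      by (auto simp: accepting_path_def partial_path_def accepting_paths_from_def)
    then show ?thesis using accepts_card[OF acc] by simp
  qed
  ultimately show ?thesis
    unfolding sharpL_def using wf_machine by blast
qed


section \<open>The program\<close>

definition transfer :: "reg \<Rightarrow> reg \<Rightarrow> cmd" where
  "transfer v w = Loop (NonZero v) (Dec v ;; Inc w)"

definition clear :: "reg \<Rightarrow> cmd" where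
  "clear v = Loop (NonZero v) (Dec v)"

text \<open>Reading a register means counting it down, so its value is rebuilt from
  \<open>Quot\<close>, which is zero outside divisions.\<close>

definition copy :: "reg \<Rightarrow> reg \<Rightarrow> cmd" where
  "copy v w = Loop (NonZero v) (Dec v ;; Inc w ;; Inc Quot) ;; transfer Quot v"

text \<open>The divisor is the sum of the registers \<^const>\<open>Divisor\<close> and \<^const>\<open>Remd\<close> throughout, so that no
  second copy of it is needed.\<close>

definition divide_loop :: cmd where
  "divide_loop = Loop (NonZero Dividend) (Dec Dividend ;; Dec Divisor ;; Inc Remd ;;
     Cond (NonZero Divisor) Skip (Inc Quot ;; transfer Remd Divisor))"

text \<open>\<open>divide_loop\<close> leaves \<open>Dividend\<close> at 0, so the loop continues
  exactly when a division without remainder has moved the quotient back. Each such division executes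
  \<open>c\<close> once.\<close>

definition valuation :: "cmd \<Rightarrow> cmd" where
  "valuation c = Loop (NonZero Dividend) (divide_loop ;;
     Cond (NonZero Remd) (transfer Remd Divisor ;; clear Quot) (c ;; transfer Quot Dividend))"

definition rewind :: cmd where
  "rewind = Loop NotLeftEnd GoLeft ;; GoRight"

text \<open>\<open>Dist\<close> serves twice: as the hook length offered to \<open>c\<close> at each
  later 1, and as the way back to the 0 from which the scan started.\<close>

definition for_hooks :: "cmd \<Rightarrow> cmd" where
  "for_hooks c = Loop NotRightEnd (Cond (IsBit False)
       (Loop NotRightEnd (Cond (IsBit True) c Skip ;; GoRight ;; Inc Dist) ;;
        Loop (NonZero Dist) (Dec Dist ;; GoLeft)) Skip ;; GoRight) ;; rewind"

definition check :: cmd where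
  "check = Cond NotRightEnd (Cond (IsBit True) Fail Skip ;; Loop NotRightEnd GoRight ;; GoLeft ;;
     Cond (IsBit False) Fail Skip ;; rewind) Skip"

text \<open>The sum of the valuations of a number at all \<open>d \<ge> 2\<close> up to it is 1 iff the number is prime.\<close>

definition weight :: cmd where
  "weight = Inc Divisor ;; copy Cand Ctr ;; Dec Ctr ;;
     Loop (NonZero Ctr) (Dec Ctr ;; Inc Divisor ;; copy Cand Dividend ;; valuation (Inc Weight))"

text \<open>The factorial is treated first, so that \<open>Expo\<close> is large enough for all
  decrements caused by the hooks.\<close>

definition exponent :: cmd where
  "exponent = copy Cells Ctr ;;
     Loop (NonZero Ctr) (copy Ctr Dividend ;; valuation (Inc Expo) ;; Dec Ctr) ;;
     for_hooks (copy Dist Dividend ;; valuation (Dec Expo))"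

text \<open>Each of the \<open>p - 1\<close> rounds of the loop offers to leave it early, which makes \<open>p\<close> ways in total.\<close>

definition branching :: cmd where
  "branching = Dec Divisor ;; Inc Remd ;;
     Loop (NonZero Divisor) ((Dec Divisor ;; Inc Remd) ;; Choose Skip (transfer Divisor Remd)) ;;
     transfer Remd Divisor"

definition power_branching :: cmd where
  "power_branching = exponent ;; Loop (NonZero Expo) (Dec Expo ;; branching)"

text \<open>A counter can only be tested for zero, so weight 1 is recognized as nonzero before and
  zero after one decrement.\<close>

definition candidate :: cmd where
  "candidate = weight ;;
     Cond (NonZero Weight) (Dec Weight ;; Cond (NonZero Weight) (clear Weight) power_branching) Skip ;;
     clear Divisor ;; Dec Cand"

definition syt_program :: cmd where
  "syt_program = check ;; for_hooks (Inc Cells) ;; copy Cells Cand ;; Loop (NonZero Cand) candidate"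

section \<open>Correctness of the subroutines\<close>

context space_bound
begin

lemma runs_cong: "runs c r h m r' h' \<Longrightarrow> m = m' \<Longrightarrow> r' = r'' \<Longrightarrow> h' = h'' \<Longrightarrow> runs c r h m' r'' h''"
  by simp

lemma runs_Seq1: "runs c r h 1 r1 h1 \<Longrightarrow> runs d r1 h1 m r2 h2 \<Longrightarrow> runs (c ;; d) r h m r2 h2"
  using runs_Seq[of c r h 1] by simp

lemma runs_Loop_step1:
  "holds t r h \<Longrightarrow> runs c r h 1 r1 h1 \<Longrightarrow> runs (Loop t c) r1 h1 m r2 h2 \<Longrightarrow> runs (Loop t c) r h m r2 h2"
  using runs_Loop_step[of t r h c 1] by simp

lemma runs_Inc': "r v + 1 < 2 ^ L \<Longrightarrow> r' = r(v := r v + 1) \<Longrightarrow> runs (Inc v) r h 1 r' h"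
  using runs_Inc by simp

lemma runs_Dec': "0 < r v \<Longrightarrow> r v < 2 ^ L \<Longrightarrow> r' = r(v := r v - 1) \<Longrightarrow> runs (Dec v) r h 1 r' h"
  using runs_Dec by simp

lemma runs_Loop1:
  assumes "\<And>i. i < n \<Longrightarrow> holds t (R i) (H i)"
    and "\<And>i. i < n \<Longrightarrow> runs c (R i) (H i) 1 (R (Suc i)) (H (Suc i))"
    and "\<not> holds t (R n) (H n)" "r = R 0" "h = H 0" "r' = R n" "h' = H n"
  shows "runs (Loop t c) r h 1 r' h'"
  using runs_Loop[of n t R H c "\<lambda>_. 1"] assms by simp

lemma runs_Cond_True: "holds t r h \<Longrightarrow> runs c r h m r' h' \<Longrightarrow> runs (Cond t c d) r h m r' h'"
  by (rule runs_Cond) simp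

lemma runs_Cond_False: "\<not> holds t r h \<Longrightarrow> runs d r h m r' h' \<Longrightarrow> runs (Cond t c d) r h m r' h'"
  by (rule runs_Cond) simp

lemma rejects_Cond_True: "holds t r h \<Longrightarrow> rejects c r h \<Longrightarrow> rejects (Cond t c d) r h"
  by (rule rejects_Cond) simp

lemma runs_transfer:
  assumes "v \<noteq> w" "r v + r w < 2 ^ L"
  shows "runs (transfer v w) r h 1 (r(v := 0, w := r v + r w)) h"
  unfolding transfer_def
proof (rule runs_Loop1[where n = "r v" and H = "\<lambda>_. h" and R = "\<lambda>i. r(v := r v - i, w := r w + i)"])
  fix i assume i: "i < r v"
  let ?R = "\<lambda>i. r(v := r v - i, w := r w + i)"
  show "runs (Dec v ;; Inc w) (?R i) h 1 (?R (Suc i)) h"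
    by (rule runs_Seq1[OF runs_Dec runs_Inc']) (use i assms in \<open>auto simp: fun_eq_iff\<close>)
qed (use assms in \<open>auto simp: fun_eq_iff\<close>)

lemma runs_clear:
  assumes "r v < 2 ^ L"
  shows "runs (clear v) r h 1 (r(v := 0)) h"
  unfolding clear_def
proof (rule runs_Loop1[where n = "r v" and H = "\<lambda>_. h" and R = "\<lambda>i. r(v := r v - i)"])
  fix i assume i: "i < r v"
  show "runs (Dec v) (r(v := r v - i)) h 1 (r(v := r v - Suc i)) h"
    by (rule runs_Dec') (use i assms in \<open>auto simp: fun_eq_iff\<close>)
qed (use assms in \<open>auto simp: fun_eq_iff\<close>)

lemma runs_copy:
  assumes "v \<noteq> w" "v \<noteq> Quot" "w \<noteq> Quot" "r Quot = 0" "r v + r w < 2 ^ L"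
  shows "runs (copy v w) r h 1 (r(w := r v + r w)) h"
  unfolding copy_def
proof (rule runs_Seq1)
  let ?R = "\<lambda>i. r(v := r v - i, w := r w + i, Quot := i)"
  show "runs (Loop (NonZero v) (Dec v ;; Inc w ;; Inc Quot)) r h 1 (?R (r v)) h"
  proof (rule runs_Loop1[where n = "r v" and H = "\<lambda>_. h" and R = ?R])
    fix i assume i: "i < r v"
    show "runs (Dec v ;; Inc w ;; Inc Quot) (?R i) h 1 (?R (Suc i)) h"
      by (rule runs_Seq1[OF runs_Dec runs_Seq1[OF runs_Inc runs_Inc']])
        (use i assms in \<open>auto simp: fun_eq_iff\<close>)
  qed (use assms in \<open>auto simp: fun_eq_iff\<close>)
  show "runs (transfer Quot v) (?R (r v)) h 1 (r(w := r v + r w)) h"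
    by (rule runs_cong[OF runs_transfer]) (use assms in \<open>auto simp: fun_eq_iff\<close>)
qed

lemma Suc_div_mod:
  fixes i p :: nat
  assumes "0 < p"
  shows "if p - i mod p = 1 then Suc i mod p = 0 \<and> Suc i div p = Suc (i div p) \<and> i mod p = p - 1
    else Suc i mod p = Suc (i mod p) \<and> Suc i div p = i div p \<and> Suc (i mod p) < p"
proof -
  have lt: "i mod p < p" using assms by simp
  show ?thesis
  proof (cases "Suc (i mod p) = p")
    case True
    then have "p - i mod p = 1" "i mod p = p - 1" by linarith+
    then show ?thesis using True assms by (simp add: mod_Suc div_Suc mod_eq_0_iff_dvd[symmetric])
  next
    case False
    then have "p - i mod p \<noteq> 1" "Suc (i mod p) < p" using lt by linarith+
    then show ?thesis using False by (simp add: mod_Suc div_Suc mod_eq_0_iff_dvd[symmetric])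
  qed
qed

lemma runs_divide_loop:
  assumes "0 < r Divisor" "r Remd = 0" "r Quot = 0" "r Divisor < 2 ^ L" "r Dividend < 2 ^ L"
  shows "runs divide_loop r h 1 (r(Dividend := 0, Divisor := r Divisor - r Dividend mod r Divisor,
    Remd := r Dividend mod r Divisor, Quot := r Dividend div r Divisor)) h"
proof -
  define p q where "p = r Divisor" and "q = r Dividend"
  note pq = assms[folded p_def q_def]
  \<comment> \<open>After \<open>i\<close> units have been consumed, \<open>Quot\<close> and
    \<open>Remd\<close> hold their quotient and remainder; \<open>Divisor\<close> holds
    \<open>p - i mod p\<close>, which is positive, so it can be decremented.\<close>
  define R where "R i = r(Dividend := q - i, Divisor := p - i mod p, Remd := i mod p, Quot := i div p)" for i
  have "runs divide_loop r h 1 (R q) h"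
    unfolding divide_loop_def
  proof (rule runs_Loop1[where n = q and H = "\<lambda>_. h" and R = R])
    fix i assume i: "i < q"
    note dm = Suc_div_mod[OF pq(1), of i]
    have mod: "i mod p < p" using pq(1) by simp
    have "i div p \<le> i" by simp
    then have div: "Suc (i div p) < 2 ^ L" using i pq by linarith
    define R1 where "R1 = r(Dividend := q - Suc i, Divisor := p - Suc (i mod p), Remd := Suc (i mod p), Quot := i div p)"
    have "runs (Cond (NonZero Divisor) Skip (Inc Quot ;; transfer Remd Divisor)) R1 h 1 (R (Suc i)) h"
    proof (cases "p - i mod p = 1")
      case False
      have "R1 = R (Suc i)" using False dm by (auto simp: R1_def R_def fun_eq_iff)
      moreover have "holds (NonZero Divisor) R1 h" using False mod by (simp add: R1_def)
      ultimately show ?thesis using runs_Cond_True runs_Skip by metis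
    next
      case True
      have "runs (Inc Quot ;; transfer Remd Divisor) R1 h 1 (R (Suc i)) h"
        by (rule runs_Seq1[OF runs_Inc runs_cong[OF runs_transfer]])
          (use True dm pq i mod div in \<open>auto simp: R1_def R_def fun_eq_iff\<close>)
      then show ?thesis using True by (intro runs_Cond_False) (simp_all add: R1_def)
    qed
    moreover have "runs (Dec Dividend) (R i) h 1 ((R i)(Dividend := q - Suc i)) h"
      by (rule runs_Dec') (use pq i in \<open>auto simp: R_def fun_eq_iff\<close>)
    moreover have "runs (Dec Divisor) ((R i)(Dividend := q - Suc i)) h 1
        ((R i)(Dividend := q - Suc i, Divisor := p - Suc (i mod p))) h"
      by (rule runs_Dec') (use pq mod in \<open>auto simp: R_def fun_eq_iff\<close>)
    moreover have "runs (Inc Remd) ((R i)(Dividend := q - Suc i, Divisor := p - Suc (i mod p))) h 1 R1 h"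
      by (rule runs_Inc') (use pq mod in \<open>auto simp: R_def R1_def fun_eq_iff\<close>)
    ultimately show "runs (Dec Dividend ;; Dec Divisor ;; Inc Remd ;;
        Cond (NonZero Divisor) Skip (Inc Quot ;; transfer Remd Divisor)) (R i) h 1 (R (Suc i)) h"
      by (meson runs_Seq1)
  qed (use pq in \<open>auto simp: R_def p_def q_def fun_eq_iff\<close>)
  then show ?thesis by (simp add: R_def p_def q_def)
qed

text \<open>\<open>F\<close> gives the content of \<open>e\<close> after a number of executions of
  \<open>c\<close>, which covers counting up as well as down; the offset \<open>s\<close> is needed
  for the induction on \<open>m\<close>. As \<open>c\<close> need only work for \<open>j\<close>
  below the multiplicity, a caller can exclude overflow or decrements at zero from a bound on the
  final value.\<close>

lemma runs_valuation:
  assumes "2 \<le> p" "p < 2 ^ L" "0 < m" "m < 2 ^ L" "e \<notin> {Divisor, Remd, Quot, Dividend}"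
    and "r Divisor = p" "r Remd = 0" "r Quot = 0" "r Dividend = m" "r e = F s"
    and "\<And>j r'. j < multiplicity p m \<Longrightarrow> r' e = F (s + j) \<Longrightarrow> runs c r' h 1 (r'(e := F (Suc (s + j)))) h"
  shows "runs (valuation c) r h 1 (r(Dividend := 0, e := F (s + multiplicity p m))) h"
  using assms(3-)
proof (induction m arbitrary: r s rule: less_induct)
  case (less m)
  let ?R1 = "r(Dividend := 0, Divisor := p - m mod p, Remd := m mod p, Quot := m div p)"
  have div: "runs divide_loop r h 1 ?R1 h"
    using runs_divide_loop[of r h] less.prems assms(1,2) by simp
  have e: "e \<noteq> Divisor" "e \<noteq> Remd" "e \<noteq> Quot" "e \<noteq> Dividend" using less.prems(3) by auto
  have nz: "holds (NonZero Dividend) r h" using less.prems by simp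
  show ?case
  proof (cases "p dvd m")
    case True
    define k where "k = m div p"
    have k: "m = p * k" "0 < k" "k < m" using True assms(1) less.prems(1) by (auto simp: k_def)
    have mult: "multiplicity p m = Suc (multiplicity p k)"
      unfolding k(1) using assms(1) k(2) by (subst multiplicity_times_same) auto
    let ?R2 = "?R1(e := F (Suc s))" and ?R3 = "r(Dividend := k, e := F (Suc s))"
    have "runs c ?R1 h 1 (?R1(e := F (Suc (s + 0)))) h"
      by (rule less.prems(9)) (use mult e less.prems(8) in simp_all)
    then have c: "runs c ?R1 h 1 ?R2 h" unfolding add_0_right .
    have t: "runs (transfer Quot Dividend) ?R2 h 1 ?R3 h"
      by (rule runs_cong[OF runs_transfer])
        (use True e k(3) less.prems(2,4-7) in \<open>auto simp: k_def[symmetric] fun_eq_iff\<close>)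
    have body: "runs (divide_loop ;; Cond (NonZero Remd) (transfer Remd Divisor ;; clear Quot)
        (c ;; transfer Quot Dividend)) r h 1 ?R3 h"
      by (rule runs_Seq1[OF div runs_Cond_False[OF _ runs_Seq1[OF c t]]]) (use True in simp)
    have IH: "runs (valuation c) ?R3 h 1 (?R3(Dividend := 0, e := F (Suc s + multiplicity p k))) h"
    proof (rule less.IH)
      fix j r' assume j: "j < multiplicity p k" "r' e = F (Suc s + j)"
      have "runs c r' h 1 (r'(e := F (Suc (s + Suc j)))) h"
        by (rule less.prems(9)) (use mult j in simp_all)
      then show "runs c r' h 1 (r'(e := F (Suc (Suc s + j)))) h"
        by (simp only: add_Suc_right add_Suc)
    qed (use k(2,3) e less.prems(2-6) in auto)
    have eq: "?R3(Dividend := 0, e := F (Suc s + multiplicity p k)) =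
        r(Dividend := 0, e := F (s + multiplicity p m))"
      using mult e by (auto simp: fun_eq_iff)
    show ?thesis
      using runs_Loop_step1[OF nz body IH[unfolded valuation_def eq]] unfolding valuation_def .
  next
    case False
    then have mod: "0 < m mod p" "m mod p < p" using assms(1) by (auto simp: dvd_eq_mod_eq_0)
    have mult: "multiplicity p m = 0" using False by (simp add: not_dvd_imp_multiplicity_0)
    let ?R2 = "r(Dividend := 0, Quot := m div p)" and ?R3 = "r(Dividend := 0)"
    have t: "runs (transfer Remd Divisor) ?R1 h 1 ?R2 h"
      by (rule runs_cong[OF runs_transfer]) (use mod assms(1,2) less.prems(4-7) in \<open>auto simp: fun_eq_iff\<close>)
    have "m div p < 2 ^ L" using less.prems(2) by (meson div_le_dividend le_less_trans)
    then have cl: "runs (clear Quot) ?R2 h 1 ?R3 h"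
      by (intro runs_cong[OF runs_clear]) (use less.prems(4-7) in \<open>auto simp: fun_eq_iff\<close>)
    have body: "runs (divide_loop ;; Cond (NonZero Remd) (transfer Remd Divisor ;; clear Quot)
        (c ;; transfer Quot Dividend)) r h 1 ?R3 h"
      by (rule runs_Seq1[OF div runs_Cond_True[OF _ runs_Seq1[OF t cl]]]) (use mod in simp)
    have "runs (valuation c) r h 1 ?R3 h"
      unfolding valuation_def by (rule runs_Loop_step1[OF nz body runs_Loop_exit]) simp
    moreover have "r(Dividend := 0, e := F (s + multiplicity p m)) = ?R3"
      using mult e less.prems(8) by (auto simp: fun_eq_iff)
    ultimately show ?thesis by (simp only:)
  qed
qed

text \<open>Bit \<open>a\<close> of the input, counted from 0, is scanned at head position \<open>a + 1\<close>.\<close>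

definition row_weight :: "(nat \<Rightarrow> nat) \<Rightarrow> nat \<Rightarrow> nat \<Rightarrow> nat" where
  "row_weight w a i = (\<Sum>j<i. if x ! (a + j) then w j else 0)"

definition total_weight :: "(nat \<Rightarrow> nat) \<Rightarrow> nat \<Rightarrow> nat" where
  "total_weight w a = (\<Sum>a'<a. if x ! a' then 0 else row_weight w a' (length x - a'))"

lemma row_weight_Suc: "row_weight w a (Suc i) = row_weight w a i + (if x ! (a + i) then w i else 0)"
  by (simp add: row_weight_def)

lemma total_weight_Suc:
  "total_weight w (Suc a) = total_weight w a + (if x ! a then 0 else row_weight w a (length x - a))"
  by (simp add: total_weight_def)

lemma total_weight_eq: "total_weight w (length x) = (\<Sum>(a, b)\<in>inversions (ones x). w (b - a))"
proof -
  let ?S = "Sigma {a. a < length x \<and> \<not> x ! a} (\<lambda>a. {j. j < length x - a \<and> x ! (a + j)})"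
  have "total_weight w (length x) =
      (\<Sum>a\<in>{a. a < length x \<and> \<not> x ! a}. \<Sum>j\<in>{j. j < length x - a \<and> x ! (a + j)}. w j)"
    unfolding total_weight_def row_weight_def
    by (simp add: sum.If_cases Int_def conj_commute)
  also have "\<dots> = (\<Sum>(a, j)\<in>?S. w j)"
    by (rule sum.Sigma) auto
  also have "\<dots> = (\<Sum>(a, b)\<in>inversions (ones x). w (b - a))"
  proof (rule sum.reindex_bij_witness[of _ "\<lambda>(a, b). (a, b - a)" "\<lambda>(a, j). (a, a + j)"])
    fix p assume p: "p \<in> ?S"
    \<comment> \<open>Offset 0 would put a 1 at position \<open>a\<close>, which carries a
      0.\<close>
    then have "snd p \<noteq> 0" by (auto intro!: Nat.gr0I)
    then show "(case p of (a, j) \<Rightarrow> (a, a + j)) \<in> inversions (ones x)"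
      using p by (auto simp: inversions_def ones_def)
  qed (auto simp: inversions_def ones_def)
  finally show ?thesis .
qed

lemma runs_rewind: "0 \<le> h \<Longrightarrow> h \<le> int (length x) + 1 \<Longrightarrow> runs rewind r h 1 r 1"
  unfolding rewind_def
proof (rule runs_Seq1)
  assume h: "0 \<le> h" "h \<le> int (length x) + 1"
  show "runs (Loop NotLeftEnd GoLeft) r h 1 r 0"
  proof (rule runs_Loop1[where n = "nat h" and R = "\<lambda>_. r" and H = "\<lambda>i. h - int i"])
    fix i assume i: "i < nat h"
    show "runs GoLeft r (h - int i) 1 r (h - int (Suc i))"
      using runs_GoLeft[of "h - int i" r] i by (simp add: algebra_simps)
  qed (use h in auto)
  show "runs GoRight r 0 1 r 1" using runs_GoRight[of 0 r] by simp
qed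

text \<open>The premise \<open>s + w d \<le> total_weight w (length x)\<close> lets the body rely on
  a bound for the complete sum, so that no partial sum needs its own estimate.\<close>

lemma runs_for_hooks:
  assumes "length x < 2 ^ L" "e \<noteq> Dist" "r Dist = 0" "r e = F 0"
    and body: "\<And>h d s. 0 < d \<Longrightarrow> d < length x \<Longrightarrow> s + w d \<le> total_weight w (length x) \<Longrightarrow>
      runs c (r(Dist := d, e := F s)) h 1 (r(Dist := d, e := F (s + w d))) h"
  shows "runs (for_hooks c) r 1 1 (r(e := F (total_weight w (length x)))) 1"
  unfolding for_hooks_def
proof (rule runs_Seq1)
  let ?n = "length x"
  let ?row = "Loop NotRightEnd (Cond (IsBit True) c Skip ;; GoRight ;; Inc Dist)"
  let ?back = "Loop (NonZero Dist) (Dec Dist ;; GoLeft)"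
  let ?R = "\<lambda>a. r(e := F (total_weight w a))"
  have mono: "total_weight w a \<le> total_weight w ?n" if "a \<le> ?n" for a
    unfolding total_weight_def by (rule sum_mono2) (use that in auto)
  have row_mono: "row_weight w a i \<le> row_weight w a j" if "i \<le> j" for a i j
    unfolding row_weight_def by (rule sum_mono2) (use that in auto)
  show "runs (Loop NotRightEnd (Cond (IsBit False) (?row ;; ?back) Skip ;; GoRight)) r 1 1
      (?R ?n) (int ?n + 1)"
  proof (rule runs_Loop1[where n = ?n and R = ?R and H = "\<lambda>a. int a + 1"])
    fix a assume a: "a < ?n"
    have "runs (Cond (IsBit False) (?row ;; ?back) Skip) (?R a) (int a + 1) 1 (?R (Suc a)) (int a + 1)"
    proof (cases "x ! a")
      case True
      then have "\<not> holds (IsBit False) (?R a) (int a + 1)" using a by simp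
      moreover have "?R a = ?R (Suc a)" using True by (simp add: total_weight_Suc)
      ultimately show ?thesis using runs_Cond_False runs_Skip by metis
    next
      case False
      let ?T = "\<lambda>i. r(Dist := i, e := F (total_weight w a + row_weight w a i))"
      let ?H = "\<lambda>i. int a + 1 + int i"
      have row: "runs ?row (?R a) (int a + 1) 1 (?T (?n - a)) (?H (?n - a))"
      proof (rule runs_Loop1[where n = "?n - a" and R = ?T and H = ?H])
        fix i assume i: "i < ?n - a"
        let ?T' = "r(Dist := i, e := F (total_weight w a + row_weight w a (Suc i)))"
        have "runs (Cond (IsBit True) c Skip) (?T i) (?H i) 1 ?T' (?H i)"
        proof (cases "x ! (a + i)")
          case True
          then have hold: "holds (IsBit True) (?T i) (?H i)" using i by (simp add: nat_add_distrib)
          have "0 < i" using True False by (cases i) auto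
          \<comment> \<open>The unfinished row is bounded by the complete row, and this by the
            complete sum.\<close>
          have "total_weight w a + row_weight w a (Suc i) \<le> total_weight w (Suc a)"
            using False row_mono[of "Suc i" "?n - a" a] i by (simp add: total_weight_Suc)
          also have "\<dots> \<le> total_weight w ?n" using mono a by simp
          finally have "total_weight w a + row_weight w a i + w i \<le> total_weight w ?n"
            using True by (simp add: row_weight_Suc add.assoc)
          from body[OF \<open>0 < i\<close> _ this, of "?H i"]
          have "runs c (?T i) (?H i) 1 ?T' (?H i)"
            using True i by (simp add: row_weight_Suc add.assoc)
          then show ?thesis using hold by (rule runs_Cond_True[rotated])
        next
          case False
          then have "\<not> holds (IsBit True) (?T i) (?H i)" using i by (simp add: nat_add_distrib)
          moreover have "?T' = ?T i" using False by (simp add: row_weight_Suc)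
          ultimately show ?thesis using runs_Cond_False runs_Skip by metis
        qed
        moreover have "runs GoRight ?T' (?H i) 1 ?T' (?H (Suc i))"
          using runs_GoRight[of "?H i" ?T'] i by (simp add: algebra_simps)
        moreover have "runs (Inc Dist) ?T' (?H (Suc i)) 1 (?T (Suc i)) (?H (Suc i))"
          by (rule runs_Inc') (use i assms in \<open>auto simp: fun_eq_iff\<close>)
        ultimately show "runs (Cond (IsBit True) c Skip ;; GoRight ;; Inc Dist)
            (?T i) (?H i) 1 (?T (Suc i)) (?H (Suc i))"
          by (meson runs_Seq1)
      qed (use a assms in \<open>auto simp: row_weight_def fun_eq_iff\<close>)
      let ?U = "\<lambda>i. (?R (Suc a))(Dist := ?n - a - i)"
      have "runs ?back (?U 0) (?H (?n - a)) 1 (?R (Suc a)) (int a + 1)"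
      proof (rule runs_Loop1[where n = "?n - a" and R = ?U and H = "\<lambda>i. ?H (?n - a) - int i"])
        fix i assume i: "i < ?n - a"
        have "runs (Dec Dist) (?U i) (?H (?n - a) - int i) 1 (?U (Suc i)) (?H (?n - a) - int i)"
          by (rule runs_Dec') (use i assms in \<open>auto simp: fun_eq_iff\<close>)
        moreover have "runs GoLeft (?U (Suc i)) (?H (?n - a) - int i) 1 (?U (Suc i)) (?H (?n - a) - int (Suc i))"
          using runs_GoLeft[of "?H (?n - a) - int i" "?U (Suc i)"] i by (simp add: algebra_simps)
        ultimately show "runs (Dec Dist ;; GoLeft) (?U i) (?H (?n - a) - int i) 1
            (?U (Suc i)) (?H (?n - a) - int (Suc i))"
          by (rule runs_Seq1)
      qed (use assms in \<open>auto simp: fun_eq_iff\<close>)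
      moreover have "?U 0 = ?T (?n - a)"
        using False assms(2) by (auto simp: total_weight_Suc fun_eq_iff)
      ultimately have "runs (?row ;; ?back) (?R a) (int a + 1) 1 (?R (Suc a)) (int a + 1)"
        using runs_Seq1[OF row] by simp
      moreover have "holds (IsBit False) (?R a) (int a + 1)" using a False by simp
      ultimately show ?thesis by (rule runs_Cond_True[rotated])
    qed
    moreover have "runs GoRight (?R (Suc a)) (int a + 1) 1 (?R (Suc a)) (int (Suc a) + 1)"
      using runs_GoRight[of "int a + 1" "?R (Suc a)"] a by (simp add: algebra_simps)
    ultimately show "runs (Cond (IsBit False) (?row ;; ?back) Skip ;; GoRight) (?R a) (int a + 1) 1
        (?R (Suc a)) (int (Suc a) + 1)"
      by (rule runs_Seq1)
  qed (use assms in \<open>auto simp: total_weight_def fun_eq_iff\<close>)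
  show "runs rewind (?R ?n) (int ?n + 1) 1 (?R ?n) 1" by (rule runs_rewind) auto
qed

lemma check_correct:
  "if maya_valid x then runs check r 1 1 r 1 else rejects check r 1"
proof (cases "x = []")
  case True
  have "\<not> holds NotRightEnd r 1" unfolding holds_simps using True by simp
  then have "runs check r 1 1 r 1"
    unfolding check_def by (rule runs_Cond_False[OF _ runs_Skip])
  then show ?thesis using True by (simp add: maya_valid_def)
next
  case False
  let ?n = "int (length x)"
  let ?c1 = "Cond (IsBit True) Fail Skip" and ?c2 = "Loop NotRightEnd GoRight"
    and ?c3 = "Cond (IsBit False) Fail Skip"
  have n: "1 \<le> ?n" using False by (cases x) auto
  have first: "x ! nat (1 - 1) = hd x" using False by (simp add: hd_conv_nth)
  have "nat (?n - 1) = length x - 1" by linarith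
  then have final: "x ! nat (?n - 1) = last x" using last_conv_nth[OF False] by (simp only:)
  have hold: "holds NotRightEnd r 1" using n by simp
  have c1: "if hd x then rejects ?c1 r 1 else runs ?c1 r 1 1 r 1"
  proof (cases "hd x")
    case True
    have "rejects ?c1 r 1" by (rule rejects_Cond_True[OF _ rejects_Fail]) (use \<open>x \<noteq> []\<close> n first True in simp)
    then show ?thesis using True by simp
  next
    case False
    have "runs ?c1 r 1 1 r 1" by (rule runs_Cond_False[OF _ runs_Skip]) (use first False in simp)
    then show ?thesis using False by simp
  qed
  have c2: "runs ?c2 r 1 1 r (?n + 1)"
  proof (rule runs_Loop1[where n = "length x" and R = "\<lambda>_. r" and H = "\<lambda>i. int i + 1"])
    fix i assume "i < length x"
    then show "runs GoRight r (int i + 1) 1 r (int (Suc i) + 1)"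
      using runs_GoRight[of "int i + 1" r] by (simp add: algebra_simps)
  qed auto
  have left: "runs GoLeft r (?n + 1) 1 r ?n" using runs_GoLeft[of "?n + 1" r] by simp
  have c3: "if last x then runs ?c3 r ?n 1 r ?n else rejects ?c3 r ?n"
  proof (cases "last x")
    case True
    have "runs ?c3 r ?n 1 r ?n" by (rule runs_Cond_False[OF _ runs_Skip]) (use final True in simp)
    then show ?thesis using True by simp
  next
    case False
    have "rejects ?c3 r ?n" by (rule rejects_Cond_True[OF _ rejects_Fail]) (use \<open>x \<noteq> []\<close> n final False in simp)
    then show ?thesis using False by simp
  qed
  have rew: "runs rewind r ?n 1 r 1" by (rule runs_rewind) auto
  show ?thesis
  proof (cases "maya_valid x")
    case True
    then have "runs (?c1 ;; ?c2 ;; GoLeft ;; ?c3 ;; rewind) r 1 1 r 1"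
      using c1 c3 False runs_Seq1[OF _ runs_Seq1[OF c2 runs_Seq1[OF left runs_Seq1[OF _ rew]]]]
      by (simp add: maya_valid_def)
    then show ?thesis using True hold runs_Cond_True unfolding check_def by simp
  next
    case invalid: False
    have "rejects (?c1 ;; ?c2 ;; GoLeft ;; ?c3 ;; rewind) r 1"
    proof (cases "hd x")
      case True
      then show ?thesis using c1 rejects_Seq1 by simp
    next
      case hd: False
      then have "\<not> last x" using invalid False by (simp add: maya_valid_def)
      then have "rejects (?c3 ;; rewind) r ?n" using c3 rejects_Seq1 by simp
      then show ?thesis
        using c1 hd by (auto intro: rejects_Seq2[OF _ rejects_Seq2[OF c2 rejects_Seq2[OF left]]])
    qed
    then show ?thesis using invalid hold rejects_Cond_True unfolding check_def by simp
  qed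
qed

end

section \<open>Primality by valuations, and bounds for all counters\<close>

lemma multiplicity_le: "2 \<le> p \<Longrightarrow> 0 < m \<Longrightarrow> multiplicity p m \<le> (m :: nat)"
proof -
  assume p: "2 \<le> p" and m: "0 < m"
  have "multiplicity p m < p ^ multiplicity p m" using p by (simp add: less_exp power_gt_expt)
  also have "\<dots> \<le> m" using m by (intro dvd_imp_le multiplicity_dvd)
  finally show ?thesis by simp
qed

definition divisor_weight :: "nat \<Rightarrow> nat" where
  "divisor_weight c = (\<Sum>d<c - 1. multiplicity (d + 2) c)"

text \<open>For \<open>c > 1\<close> the divisor \<open>c\<close> itself contributes exactly 1, so
  the sum is 1 iff no smaller \<open>d \<ge> 2\<close> divides \<open>c\<close>. For
  \<open>c = 1\<close> the sum is empty.\<close>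

lemma divisor_weight_eq_1_iff:
  assumes "0 < c"
  shows "divisor_weight c = 1 \<longleftrightarrow> prime c"
proof (cases "c = 1")
  case False
  then obtain k where c: "c = Suc (Suc k)" using assms by (metis One_nat_def not0_implies_Suc not_gr0)
  have "divisor_weight c = (\<Sum>d<k. multiplicity (d + 2) c) + multiplicity c c"
    unfolding divisor_weight_def c by simp
  also have "multiplicity c c = 1" by (rule multiplicity_self) (auto simp: c)
  finally have "divisor_weight c = 1 \<longleftrightarrow> (\<forall>d<k. multiplicity (d + 2) c = 0)" by auto
  also have "\<dots> \<longleftrightarrow> (\<forall>d<k. \<not> d + 2 dvd c)"
    using assms by (simp add: multiplicity_eq_zero_iff)
  also have "\<dots> \<longleftrightarrow> (\<forall>n\<in>{2..<c}. \<not> n dvd c)"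
  proof (intro iffI ballI)
    fix n assume "\<forall>d<k. \<not> d + 2 dvd c" "n \<in> {2..<c}"
    moreover from this(2) have "n - 2 < k" "n - 2 + 2 = n" unfolding c by auto
    ultimately show "\<not> n dvd c" by metis
  qed (auto simp: c)
  also have "\<dots> \<longleftrightarrow> prime c" using c by (simp add: prime_nat_iff')
  finally show ?thesis .
qed (simp add: divisor_weight_def)

lemma divisor_weight_le: "divisor_weight c \<le> c * c"
proof -
  have "divisor_weight c \<le> (\<Sum>d<c - 1. c)"
    unfolding divisor_weight_def by (intro sum_mono multiplicity_le) auto
  also have "\<dots> \<le> c * c" by (simp add: mult_le_mono1)
  finally show ?thesis .
qed

text \<open>The number of cells is at most the square of the input length, and weights and exponents
  are at most the square of that: hence the fourth power. Adding 2 makes the bounds strict.\<close>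

locale program_space = space_bound +
  assumes space: "(length x + 2) ^ 4 \<le> 2 ^ L"
begin

definition N :: nat where
  "N = card (inversions (ones x))"

lemma N_le: "N \<le> length x * length x"
proof -
  have "inversions (ones x) \<subseteq> {..<length x} \<times> {..<length x}" by (auto simp: inversions_def ones_def)
  then have "N \<le> card ({..<length x} \<times> {..<length x})" unfolding N_def by (intro card_mono) auto
  then show ?thesis by simp
qed

lemma bounds: "N * N < 2 ^ L" "Suc N < 2 ^ L" "length x < 2 ^ L"
proof -
  let ?n = "length x"
  have e: "(?n + 2) ^ 4 = (?n * ?n) * (?n * ?n) + 8 * (?n * ?n * ?n) + 24 * (?n * ?n) + 32 * ?n + 16"
    by (simp add: numeral_eq_Suc algebra_simps)
  have "N * N \<le> (?n * ?n) * (?n * ?n)" using N_le by (intro mult_le_mono)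
  then show "N * N < 2 ^ L" using space e by linarith
  show "Suc N < 2 ^ L" using space e N_le by linarith
  show "?n < 2 ^ L" using space e by linarith
qed

text \<open>The register contents between two candidates; all auxiliary registers are back at
  0.\<close>

definition base :: "nat \<Rightarrow> reg \<Rightarrow> nat" where
  "base c = (\<lambda>_. 0)(Cells := N, Cand := c)"

lemma runs_weight:
  assumes "0 < c" "c \<le> N"
  shows "runs weight (base c) h 1 ((base c)(Divisor := c, Weight := divisor_weight c)) h"
proof -
  define W where "W i = (\<Sum>d<i. multiplicity (d + 2) c)" for i
  \<comment> \<open>\<open>Divisor\<close> is raised before it is used, so rounds \<open>0\<close>
    to \<open>c - 2\<close> test the divisors \<open>2\<close> to \<open>c\<close>.\<close>
  define R where "R i = (base c)(Divisor := Suc i, Ctr := c - 1 - i, Weight := W i)" for i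
  have c: "Suc c < 2 ^ L" using assms(2) bounds(2) by linarith
  have WSuc: "W (Suc i) = W i + multiplicity (i + 2) c" for i by (simp add: W_def)
  have W: "W i \<le> N * N" if "i < c" for i
  proof -
    have "W i \<le> (\<Sum>d<i. c)" unfolding W_def using assms(1) by (intro sum_mono multiplicity_le) auto
    also have "\<dots> \<le> N * N" using that assms(2) by (simp add: mult_le_mono)
    finally show ?thesis .
  qed
  have body: "runs (Dec Ctr ;; Inc Divisor ;; copy Cand Dividend ;; valuation (Inc Weight))
      (R i) h 1 (R (Suc i)) h" if i: "i < c - 1" for i
  proof -
    let ?R1 = "(R i)(Ctr := c - 1 - Suc i)"
    let ?R2 = "?R1(Divisor := i + 2)"
    let ?R3 = "?R2(Dividend := c)"
    have 1: "runs (Dec Ctr) (R i) h 1 ?R1 h"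
      by (rule runs_Dec') (use i c in \<open>auto simp: R_def fun_eq_iff\<close>)
    have 2: "runs (Inc Divisor) ?R1 h 1 ?R2 h"
      by (rule runs_Inc') (use i c in \<open>auto simp: R_def fun_eq_iff\<close>)
    have 3: "runs (copy Cand Dividend) ?R2 h 1 ?R3 h"
      by (rule runs_cong[OF runs_copy]) (use i c in \<open>auto simp: R_def base_def fun_eq_iff\<close>)
    have 4: "runs (valuation (Inc Weight)) ?R3 h 1
        (?R3(Dividend := 0, Weight := W i + multiplicity (i + 2) c)) h"
    proof (rule runs_valuation[where F = "\<lambda>j. j"])
      fix j r' assume j: "j < multiplicity (i + 2) c" "r' Weight = W i + j"
      then have "Suc (W i + j) \<le> W (Suc i)" by (simp add: WSuc)
      also have "\<dots> \<le> N * N" using i by (intro W) simp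
      finally have "Suc (W i + j) < 2 ^ L" using bounds(1) by simp
      then show "runs (Inc Weight) r' h 1 (r'(Weight := Suc (W i + j))) h"
        by (intro runs_Inc') (simp_all add: j(2))
    qed (use i c assms in \<open>auto simp: R_def base_def\<close>)
    have eq: "?R3(Dividend := 0, Weight := W i + multiplicity (i + 2) c) = R (Suc i)"
      by (auto simp: R_def base_def WSuc fun_eq_iff)
    show ?thesis
      using runs_Seq1[OF 1 runs_Seq1[OF 2 runs_Seq1[OF 3 4]]] unfolding eq .
  qed
  have 1: "runs (Inc Divisor) (base c) h 1 ((base c)(Divisor := 1)) h"
    by (rule runs_Inc') (use c in \<open>auto simp: base_def fun_eq_iff\<close>)
  have 2: "runs (copy Cand Ctr) ((base c)(Divisor := 1)) h 1 ((base c)(Divisor := 1, Ctr := c)) h"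
    by (rule runs_cong[OF runs_copy]) (use c in \<open>auto simp: base_def fun_eq_iff\<close>)
  have 3: "runs (Dec Ctr) ((base c)(Divisor := 1, Ctr := c)) h 1 (R 0) h"
    by (rule runs_Dec') (use c assms in \<open>auto simp: R_def W_def base_def fun_eq_iff\<close>)
  have 4: "runs (Loop (NonZero Ctr) (Dec Ctr ;; Inc Divisor ;; copy Cand Dividend ;; valuation (Inc Weight)))
      (R 0) h 1 (R (c - 1)) h"
    by (rule runs_Loop1[where n = "c - 1" and R = R and H = "\<lambda>_. h"]) (use body in \<open>auto simp: R_def\<close>)
  have eq: "R (c - 1) = (base c)(Divisor := c, Weight := divisor_weight c)"
    using assms by (auto simp: R_def W_def divisor_weight_def base_def fun_eq_iff)
  show ?thesis
    using runs_Seq1[OF 1 runs_Seq1[OF 2 runs_Seq1[OF 3 4]]] unfolding weight_def eq .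
qed

lemma runs_exponent:
  assumes "maya_valid x" "prime p" "p \<le> N"
  shows "runs exponent ((base p)(Divisor := p)) 1 1 ((base p)(Divisor := p, Expo := syt_exponent x p)) 1"
proof -
  define r where "r = (base p)(Divisor := p)"
  define E where "E i = (\<Sum>j<i. multiplicity p (N - j))" for i
  define R where "R i = r(Ctr := N - i, Expo := E i)" for i
  have p: "2 \<le> p" "p < 2 ^ L" using assms prime_ge_2_nat bounds(2) by auto
  have ESuc: "E (Suc i) = E i + multiplicity p (N - i)" for i by (simp add: E_def)
  have E: "E i \<le> N * N" if "i \<le> N" for i
  proof -
    have "E i \<le> (\<Sum>j<i. N)" unfolding E_def
    proof (rule sum_mono)
      fix j assume "j \<in> {..<i}"
      then have "multiplicity p (N - j) \<le> N - j" using p that by (intro multiplicity_le) auto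
      then show "multiplicity p (N - j) \<le> N" by simp
    qed
    also have "\<dots> \<le> N * N" using that by (simp add: mult_le_mono)
    finally show ?thesis .
  qed
  have EN: "E N = (\<Sum>m=1..N. multiplicity p m)"
    unfolding E_def by (rule sum.reindex_bij_witness[of _ "\<lambda>m. N - m" "\<lambda>j. N - j"]) auto
  define w where "w = multiplicity p"
  have T: "total_weight w (length x) = (\<Sum>(a, b)\<in>inversions (ones x). multiplicity p (b - a))"
    unfolding w_def by (rule total_weight_eq)
  \<comment> \<open>This keeps every \<open>Dec Expo\<close> away from zero.\<close>
  have T_le: "total_weight w (length x) \<le> E N"
    using syt_exponent(1)[OF assms(1,2), folded N_def] unfolding T EN .
  have exp: "E N - total_weight w (length x) = syt_exponent x p"
    unfolding syt_exponent_def T EN N_def[symmetric] ..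
  have body: "runs (copy Ctr Dividend ;; valuation (Inc Expo) ;; Dec Ctr) (R i) 1 1 (R (Suc i)) 1"
    if i: "i < N" for i
  proof -
    let ?R1 = "(R i)(Dividend := N - i)"
    let ?R2 = "?R1(Dividend := 0, Expo := E i + multiplicity p (N - i))"
    have 1: "runs (copy Ctr Dividend) (R i) 1 1 ?R1 1"
      by (rule runs_cong[OF runs_copy]) (use i bounds(2) in \<open>auto simp: R_def r_def base_def fun_eq_iff\<close>)
    have 2: "runs (valuation (Inc Expo)) ?R1 1 1 ?R2 1"
    proof (rule runs_valuation[where F = "\<lambda>j. j"])
      fix j r' assume j: "j < multiplicity p (N - i)" "r' Expo = E i + j"
      then have "Suc (E i + j) \<le> E (Suc i)" by (simp add: ESuc)
      also have "\<dots> \<le> N * N" using i by (intro E) simp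
      finally have "Suc (E i + j) < 2 ^ L" using bounds(1) by simp
      then show "runs (Inc Expo) r' 1 1 (r'(Expo := Suc (E i + j))) 1"
        by (intro runs_Inc') (simp_all add: j(2))
    qed (use i p bounds(2) in \<open>auto simp: R_def r_def base_def\<close>)
    have 3: "runs (Dec Ctr) ?R2 1 1 (R (Suc i)) 1"
      by (rule runs_Dec') (use i bounds(2) in \<open>auto simp: R_def r_def base_def ESuc fun_eq_iff\<close>)
    show ?thesis by (rule runs_Seq1[OF 1 runs_Seq1[OF 2 3]])
  qed
  have 1: "runs (copy Cells Ctr) r 1 1 (R 0) 1"
    by (rule runs_cong[OF runs_copy]) (use bounds(2) in \<open>auto simp: R_def r_def base_def E_def fun_eq_iff\<close>)
  have 2: "runs (Loop (NonZero Ctr) (copy Ctr Dividend ;; valuation (Inc Expo) ;; Dec Ctr))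
      (R 0) 1 1 (R N) 1"
    by (rule runs_Loop1[where n = N and R = R and H = "\<lambda>_. 1"]) (use body in \<open>auto simp: R_def\<close>)
  have 3: "runs (for_hooks (copy Dist Dividend ;; valuation (Dec Expo))) (R N) 1 1
      ((R N)(Expo := E N - total_weight w (length x))) 1"
  \<comment> \<open>Here \<open>Expo\<close> counts down: the total subtracted so far is
    \<open>t\<close>.\<close>
  proof (rule runs_for_hooks[where F = "\<lambda>t. E N - t"])
    fix h d s assume d: "0 < d" "d < length x" "s + w d \<le> total_weight w (length x)"
    let ?R1 = "(R N)(Dist := d, Expo := E N - s)"
    let ?R2 = "?R1(Dividend := d)"
    have 4: "runs (copy Dist Dividend) ?R1 h 1 ?R2 h"
      by (rule runs_cong[OF runs_copy]) (use d bounds(3) in \<open>auto simp: R_def r_def base_def fun_eq_iff\<close>)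
    have 5: "runs (valuation (Dec Expo)) ?R2 h 1 (?R2(Dividend := 0, Expo := E N - (s + multiplicity p d))) h"
    proof (rule runs_valuation[where F = "\<lambda>t. E N - t"])
      fix j r' assume j: "j < multiplicity p d" "r' Expo = E N - (s + j)"
      then have "s + j < E N" using d(3) T_le by (simp add: w_def)
      moreover have "E N < 2 ^ L" using E[of N] bounds(1) by simp
      ultimately show "runs (Dec Expo) r' h 1 (r'(Expo := E N - Suc (s + j))) h"
        by (intro runs_Dec') (auto simp: j(2))
    qed (use d p bounds(3) in \<open>auto simp: R_def r_def base_def\<close>)
    have eq: "?R2(Dividend := 0, Expo := E N - (s + multiplicity p d)) =
        (R N)(Dist := d, Expo := E N - (s + w d))"
      by (auto simp: R_def r_def base_def w_def fun_eq_iff)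
    show "runs (copy Dist Dividend ;; valuation (Dec Expo)) ?R1 h 1
        ((R N)(Dist := d, Expo := E N - (s + w d))) h"
      using runs_Seq1[OF 4 5] unfolding eq .
  qed (use bounds(3) in \<open>auto simp: R_def r_def base_def\<close>)
  have eq: "(R N)(Expo := E N - total_weight w (length x)) = r(Expo := syt_exponent x p)"
    unfolding exp by (auto simp: R_def r_def base_def fun_eq_iff)
  show ?thesis
    using runs_Seq1[OF 1 runs_Seq1[OF 2 3]] unfolding exponent_def eq unfolding r_def .
qed

lemma runs_branching:
  assumes "0 < r Divisor" "r Divisor < 2 ^ L" "r Remd = 0"
  shows "runs branching r h (r Divisor) r h"
proof -
  define p where "p = r Divisor"
  note p = assms[folded p_def]
  define R where "R q = r(Divisor := q, Remd := p - q)" for q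
  let ?a = "Dec Divisor ;; Inc Remd"
  let ?loop = "Loop (NonZero Divisor) (?a ;; Choose Skip (transfer Divisor Remd))"
  have a: "runs ?a (R (Suc q)) h 1 (R q) h" if "q < p" for q
    by (rule runs_Seq1[OF runs_Dec runs_Inc']) (use that p in \<open>auto simp: R_def fun_eq_iff\<close>)
  \<comment> \<open>Moving the rest of \<open>Divisor\<close> to \<open>Remd\<close> ends the loop
    in the same registers \<open>R 0\<close> as going on. With \<open>Suc q\<close> rounds left
    there is one way to leave and \<open>Suc q\<close> ways to continue. Even in the last round,
    where the transfer moves nothing, the two paths differ in their stacks.\<close>
  have loop: "runs ?loop (R q) h (Suc q) (R 0) h" if "q < p" for q
    using that
  proof (induction q)
    case 0
    show ?case unfolding One_nat_def[symmetric] by (rule runs_Loop_exit) (simp add: R_def)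
  next
    case (Suc q)
    have t: "runs (transfer Divisor Remd) (R q) h 1 (R 0) h"
      by (rule runs_cong[OF runs_transfer]) (use Suc.prems p in \<open>auto simp: R_def fun_eq_iff\<close>)
    have "runs ?loop (R (Suc q)) h (1 * Suc q + 1 * 1) (R 0) h"
    proof (rule runs_Loop_Choose)
      show "runs ?a (R (Suc q)) h 1 (R q) h" using Suc.prems by (intro a) simp
      show "runs Skip (R q) h 1 (R q) h" by (rule runs_Skip)
      show "runs ?loop (R q) h (Suc q) (R 0) h" using Suc by simp
      show "runs ?loop (R 0) h 1 (R 0) h" by (rule runs_Loop_exit) (simp add: R_def)
    qed (use t in \<open>auto simp: R_def transfer_def\<close>)
    then show ?case by simp
  qed
  have start1: "runs (Dec Divisor) r h 1 (r(Divisor := p - 1)) h"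
    by (rule runs_Dec') (use assms in \<open>auto simp: p_def\<close>)
  have start2: "runs (Inc Remd) (r(Divisor := p - 1)) h 1 (R (p - 1)) h"
    by (rule runs_Inc') (use p in \<open>auto simp: R_def fun_eq_iff\<close>)
  have "runs (transfer Remd Divisor) (R 0) h 1 r h"
    by (rule runs_cong[OF runs_transfer]) (use p in \<open>auto simp: R_def p_def fun_eq_iff\<close>)
  from runs_Seq1[OF start1 runs_Seq1[OF start2 runs_Seq[OF loop this]]]
  show ?thesis using p unfolding branching_def p_def by simp
qed

lemma runs_power_branching:
  assumes "maya_valid x" "prime p" "p \<le> N"
  shows "runs power_branching ((base p)(Divisor := p)) 1 (p ^ syt_exponent x p) ((base p)(Divisor := p)) 1"
proof -
  let ?e = "syt_exponent x p"
  define R where "R i = (base p)(Divisor := p, Expo := ?e - i)" for i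
  have p: "0 < p" "p < 2 ^ L" using assms prime_gt_0_nat bounds(2) by auto
  have e: "?e < 2 ^ L"
  proof -
    have "?e \<le> (\<Sum>m=1..N. multiplicity p m)" by (simp add: syt_exponent_def N_def)
    also have "\<dots> \<le> (\<Sum>m=1..N. N)"
    proof (rule sum_mono)
      fix m assume "m \<in> {1..N}"
      then show "multiplicity p m \<le> N"
        using multiplicity_le[of p m] prime_ge_2_nat[OF assms(2)] by simp
    qed
    also have "\<dots> < 2 ^ L" using bounds(1) by simp
    finally show ?thesis .
  qed
  have 1: "runs (Loop (NonZero Expo) (Dec Expo ;; branching)) (R 0) 1 (\<Prod>i<?e. p) (R ?e) 1"
  proof (rule runs_Loop[where R = R and H = "\<lambda>_. 1"])
    fix i assume i: "i < ?e"
    have "runs (Dec Expo) (R i) 1 1 (R (Suc i)) 1"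
      by (rule runs_Dec') (use i e in \<open>auto simp: R_def fun_eq_iff\<close>)
    moreover have "runs branching (R (Suc i)) 1 p (R (Suc i)) 1"
      using runs_branching[of "R (Suc i)" 1] p by (simp add: R_def base_def)
    ultimately show "runs (Dec Expo ;; branching) (R i) 1 p (R (Suc i)) 1"
      by (rule runs_Seq1)
  qed (auto simp: R_def)
  have 2: "runs exponent ((base p)(Divisor := p)) 1 1 (R 0) 1"
    using runs_exponent[OF assms] by (simp add: R_def)
  have eq: "R ?e = (base p)(Divisor := p)" by (auto simp: R_def base_def fun_eq_iff)
  show ?thesis
    using runs_Seq1[OF 2 1] unfolding power_branching_def eq prod_constant card_lessThan .
qed

lemma runs_candidate:
  assumes "maya_valid x" "0 < c" "c \<le> N"
  shows "runs candidate (base c) 1 (if prime c then c ^ syt_exponent x c else 1) (base (c - 1)) 1"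
proof -
  let ?w = "divisor_weight c" and ?m = "if prime c then c ^ syt_exponent x c else 1"
  let ?R = "(base c)(Divisor := c)"
  let ?c = "Dec Weight ;; Cond (NonZero Weight) (clear Weight) power_branching"
  have "c * c \<le> N * N" using assms(3) by (intro mult_le_mono)
  then have w: "?w < 2 ^ L" using divisor_weight_le[of c] bounds(1) by linarith
  have prime: "?w = 1 \<longleftrightarrow> prime c" by (rule divisor_weight_eq_1_iff[OF assms(2)])
  have cond: "runs (Cond (NonZero Weight) ?c Skip) (?R(Weight := ?w)) 1 ?m ?R 1"
  proof (cases "?w = 0")
    case True
    then have "?R(Weight := ?w) = ?R" by (auto simp: base_def fun_eq_iff)
    moreover have "\<not> prime c" using True prime by auto
    moreover have "runs (Cond (NonZero Weight) ?c Skip) ?R 1 1 ?R 1"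
      by (rule runs_Cond_False[OF _ runs_Skip]) (simp add: base_def)
    ultimately show ?thesis by (simp only: if_False)
  next
    case False
    have 1: "runs (Dec Weight) (?R(Weight := ?w)) 1 1 (?R(Weight := ?w - 1)) 1"
      by (rule runs_Dec') (use False w in \<open>auto simp: fun_eq_iff\<close>)
    have "runs (Cond (NonZero Weight) (clear Weight) power_branching) (?R(Weight := ?w - 1)) 1 ?m ?R 1"
    proof (cases "?w = 1")
      case True
      then have "?R(Weight := ?w - 1) = ?R" by (auto simp: base_def fun_eq_iff)
      moreover have "prime c" using True prime by simp
      moreover have "runs (Cond (NonZero Weight) (clear Weight) power_branching) ?R 1 (c ^ syt_exponent x c) ?R 1"
        by (rule runs_Cond_False[OF _ runs_power_branching]) (use assms \<open>prime c\<close> in \<open>auto simp: base_def\<close>)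
      ultimately show ?thesis by (simp only: if_True)
    next
      case more: False
      have "runs (clear Weight) (?R(Weight := ?w - 1)) 1 1 ?R 1"
        by (rule runs_cong[OF runs_clear]) (use w in \<open>auto simp: base_def fun_eq_iff\<close>)
      then have "runs (Cond (NonZero Weight) (clear Weight) power_branching) (?R(Weight := ?w - 1)) 1 1 ?R 1"
        by (rule runs_Cond_True[rotated]) (use more False in auto)
      then show ?thesis using more prime by simp
    qed
    from runs_Seq1[OF 1 this] show ?thesis
      by (rule runs_Cond_True[rotated]) (use False in simp)
  qed
  have weight: "runs weight (base c) 1 1 (?R(Weight := ?w)) 1"
    by (rule runs_weight) (use assms in auto)
  have clear: "runs (clear Divisor) ?R 1 1 (base c) 1"
    by (rule runs_cong[OF runs_clear]) (use assms bounds(2) in \<open>auto simp: base_def fun_eq_iff\<close>)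
  have dec: "runs (Dec Cand) (base c) 1 1 (base (c - 1)) 1"
    by (rule runs_Dec') (use assms bounds(2) in \<open>auto simp: base_def fun_eq_iff\<close>)
  show ?thesis
    using runs_Seq1[OF weight runs_Seq[OF cond runs_Seq1[OF clear dec]]]
    unfolding candidate_def mult_1_right .
qed

lemma runs_syt_program:
  assumes "maya_valid x"
  shows "runs syt_program (\<lambda>_. 0) 1 (maya_syt_count x) (base 0) 1"
proof -
  let ?m = "\<lambda>p. if prime p then p ^ syt_exponent x p else 1"
  have 1: "runs check (\<lambda>_. 0) 1 1 (\<lambda>_. 0) 1" using check_correct assms by simp
  have 2: "runs (for_hooks (Inc Cells)) (\<lambda>_. 0) 1 1 ((\<lambda>_. 0)(Cells := N)) 1"
  proof -
    have N: "total_weight (\<lambda>_. 1) (length x) = N" by (simp add: total_weight_eq N_def)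
    have "runs (for_hooks (Inc Cells)) (\<lambda>_. 0) 1 1
        ((\<lambda>_. 0)(Cells := total_weight (\<lambda>_. 1) (length x))) 1"
    proof (rule runs_for_hooks[where F = "\<lambda>t. t"])
      fix h d s assume "s + 1 \<le> total_weight (\<lambda>_. 1) (length x)"
      then show "runs (Inc Cells) ((\<lambda>_. 0)(Dist := d, Cells := s)) h 1
          ((\<lambda>_. 0)(Dist := d, Cells := s + 1)) h"
        unfolding N by (intro runs_Inc') (use bounds(2) in auto)
    qed (use bounds(3) in auto)
    then show ?thesis unfolding N .
  qed
  have 3: "runs (copy Cells Cand) ((\<lambda>_. 0)(Cells := N)) 1 1 (base N) 1"
    by (rule runs_cong[OF runs_copy]) (use bounds(2) in \<open>auto simp: base_def fun_eq_iff\<close>)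
  have 4: "runs (Loop (NonZero Cand) candidate) (base (N - 0)) 1 (\<Prod>i<N. ?m (N - i)) (base (N - N)) 1"
  proof (rule runs_Loop[where R = "\<lambda>i. base (N - i)" and H = "\<lambda>_. 1"])
    fix i assume "i < N"
    then show "runs candidate (base (N - i)) 1 (?m (N - i)) (base (N - Suc i)) 1"
      using runs_candidate[OF assms, of "N - i"] by simp
  qed (auto simp: base_def)
  \<comment> \<open>The candidates are visited from \<open>N\<close> down to 1.\<close>
  have eq: "(\<Prod>i<N. ?m (N - i)) = maya_syt_count x"
    unfolding syt_count_prime_powers[OF assms] N_def[symmetric]
    by (rule prod.reindex_bij_witness[of _ "\<lambda>p. N - p" "\<lambda>i. N - i"]) auto
  show ?thesis
    using runs_Seq1[OF 1 runs_Seq1[OF 2 runs_Seq1[OF 3 4[unfolded diff_zero diff_self_eq_0 eq]]]]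
    unfolding syt_program_def .
qed

lemma rejects_syt_program: "\<not> maya_valid x \<Longrightarrow> rejects syt_program (\<lambda>_. 0) 1"
  using check_correct[of "\<lambda>_. 0"] rejects_Seq1 by (simp add: syt_program_def)

end

section \<open>The logarithmic space bound\<close>

definition bit_length :: "nat \<Rightarrow> nat" where
  "bit_length n = (LEAST l. n \<le> 2 ^ l)"

lemma le_power_bit_length: "n \<le> 2 ^ bit_length n"
  unfolding bit_length_def by (rule LeastI[of _ n]) (simp add: less_imp_le)

text \<open>Minimality gives \<open>2 ^ k < n + 2 \<le> n * n\<close> for the length
  \<open>Suc k\<close>, so \<open>k\<close> is below twice the binary logarithm of \<open>n\<close>;
  the remaining 1 is at most one more such logarithm.\<close>

lemma bit_length_le:
  assumes "2 \<le> n"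
  shows "real (bit_length (n + 2)) \<le> 3 / ln 2 * ln (real n)"
proof -
  have "bit_length (n + 2) \<noteq> 0" using le_power_bit_length[of "n + 2"] by (intro notI) simp
  then obtain k where k: "bit_length (n + 2) = Suc k" by (metis not0_implies_Suc)
  then have "\<not> n + 2 \<le> 2 ^ k"
    unfolding bit_length_def by (intro not_less_Least) simp
  then have "2 ^ k < n + 2" by simp
  also have "n + 2 \<le> n * n"
    using assms mult_le_mono1[of 2 n n] by linarith
  finally have "real (2 ^ k) < real (n * n)" by (simp only: of_nat_less_iff)
  then have "ln (2 ^ k) < ln (real n * real n)"
    using assms by (subst ln_less_cancel_iff) auto
  then have "real k * ln 2 < 2 * ln (real n)"
    using assms by (simp add: ln_realpow ln_mult)
  moreover have "ln 2 \<le> ln (real n)" using assms by (subst ln_le_cancel_iff) auto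
  ultimately have "real (Suc k) * ln 2 \<le> 3 * ln (real n)"
    by (simp add: algebra_simps)
  then show ?thesis unfolding k by (simp add: field_simps)
qed

text \<open>The constant is \<open>140 = 40 * 3 + 20\<close>: the length is at most three binary
  logarithms of \<open>n\<close>, and 1 is at most one.\<close>

lemma space_bigo: "(\<lambda>n. real (10 * (4 * bit_length (n + 2) + 2))) \<in> O(\<lambda>n. ln (real n))"
proof (rule bigoI)
  show "\<forall>\<^sub>F n in sequentially. norm (real (10 * (4 * bit_length (n + 2) + 2))) \<le>
      (140 / ln 2) * norm (ln (real n))"
    using eventually_ge_at_top[of 2]
  proof eventually_elim
    case (elim n)
    have ln: "ln 2 \<le> ln (real n)" using elim by (subst ln_le_cancel_iff) auto
    then have "1 \<le> ln (real n) / ln 2" by (simp add: field_simps)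
    moreover have "real (bit_length (n + 2)) \<le> 3 * (ln (real n) / ln 2)"
      using bit_length_le[OF elim] by simp
    moreover have "real (10 * (4 * bit_length (n + 2) + 2)) = 40 * real (bit_length (n + 2)) + 20"
      by (simp only: of_nat_mult of_nat_add of_nat_numeral) (simp only: algebra_simps)
    ultimately have "real (10 * (4 * bit_length (n + 2) + 2)) \<le> 140 * (ln (real n) / ln 2)"
      by linarith
    moreover have "0 \<le> ln (real n)" using elim by (intro ln_ge_zero) simp
    ultimately show ?case by (simp only: real_norm_def abs_of_nonneg of_nat_0_le_iff) simp
  qed
qed

theorem theorem5p15: "maya_syt_count \<in> sharpL"
proof (rule sharpL_machine[OF space_bigo])
  fix x :: "bool list"
  \<comment> \<open>The factor 4 pays for the fourth power in \<open>space\<close>. This bound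
    occurs only in the analysis; the program never computes it.\<close>
  interpret program_space syt_program x "4 * bit_length (length x + 2)"
  proof
    have "(length x + 2) ^ 4 \<le> (2 ^ bit_length (length x + 2)) ^ 4"
      by (intro power_mono le_power_bit_length) simp
    then show "(length x + 2) ^ 4 \<le> 2 ^ (4 * bit_length (length x + 2))"
      by (simp only: power_mult[symmetric] mult.commute[of 4])
  qed
  show "rejects syt_program (\<lambda>_. 0) 1 \<and> maya_syt_count x = 0 \<or>
      (\<exists>r h. runs syt_program (\<lambda>_. 0) 1 (maya_syt_count x) r h)"
    using runs_syt_program rejects_syt_program maya_syt_count_invalid by blast
qed

end
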